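(* Let $\{X_t : t\in\mathbb{Z}\}$ be a time series with values in $\mathbb{R}^d$ defined on a probability space $(\Omega,\mathcal{A},\mathbb{P})$, each $X_t$ having a Lebesgue-absolutely continuous distribution. Let $\mathcal{F}_{\le t}=\sigma(X_s : s\le t)$, and let $\mathbb{Q}_{t+1|t}$, $\mathbb{F}_{t+1|t}$ and $\mathcal{R}_{t+1|t}(\tau|\omega)$ be the one-step-ahead prediction quantile set-valued mapping, the one-step-ahead prediction distribution set-valued mapping and the one-step-ahead prediction quantile region defined in the context. Then, for every $\tau\in(0,1)$, $$\{\omega\in\Omega: X_{t+1}(\omega)\in\mathcal{R}_{t+1|t}(\tau|\omega)\}=\{\omega\in\Omega:\ \mathbb{F}_{t+1|t}(X_{t+1}(\omega),\omega)\cap\tau\,\overline{\mathbb{B}^d}\neq\emptyset\}\in\mathcal{A},$$ and $$\mathbb{P}\big(X_{t+1}\in\mathcal{R}_{t+1|t}(\tau|\cdot)\,\big|\,\mathcal{F}_{\le t}\big)\ge\tau\qquad\mathbb{P}\text{-a.s.}$$ If, moreover, the conditional distribution $\mathbb{P}_{X_{t+1}|\mathcal{F}_{\le t}}(\cdot,\omega)$ is absolutely continuous with respect to the Lebesgue measure $\ell_d$ on $\mathbb{R}^d$ for $\mathbb{P}$-almost every $\omega$, then, for every $\tau\in(0,1)$, $$\mathbb{P}\big(X_{t+1}\in\mathcal{R}_{t+1|t}(\tau|\cdot)\,\big|\,\mathcal{F}_{\le t}\big)=\tau\qquad\mathbb{P}\text{-a.s.}$$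
   Context: $\mathbb{B}^d=\{u\in\mathbb{R}^d:\|u\|<1\}$; $\tau\overline{\mathbb{B}^d}$ is the closed ball with center $0$ and radius $\tau$. $\mu_d$ is the spherical uniform distribution over $\mathbb{B}^d$: the law of $R\sigma$ with $R$ uniform on $[0,1]$, $\sigma$ uniform on the unit sphere $\mathcal{S}^{d-1}$, $R$ and $\sigma$ independent. Set-valued quantile mapping of a probability measure $\nu$ on $\mathbb{R}^d$: by McCann's theorem there is a convex function $\varphi$ on $\mathbb{B}^d$, unique up to an additive constant, whose ($\mu_d$-a.e. defined) gradient $\nabla\varphi$ pushes $\mu_d$ forward to $\nu$. The set-valued quantile mapping of $\nu$ is $\mathbb{Q}_\pm=\partial\varphi$, where for $u\in\mathbb{B}^d$, $\partial\varphi(u)=\{x\in\mathbb{R}^d:\varphi(v)\ge\varphi(u)+\langle x,v-u\rangle\ \text{for all }v\in\mathbb{B}^d\}$. Conditional maps: for a random vector $X$ with values in $\mathbb{R}^d$ and a sub-$\sigma$-field $\mathcal{G}\subseteq\mathcal{A}$, let $\mathbb{P}_{X|\mathcal{G}}(\cdot,\omega)$ be the regular conditional distribution of $X$ given $\mathcal{G}$. The set-valued center-outward quantile map of $X$ conditional on $\mathcal{G}$ is $(u,\omega)\mapsto\mathbb{Q}_{X|\mathcal{G}}(u|\omega)\in 2^{\mathbb{R}^d}$ such that, for every $\omega$, $\mathbb{Q}_{X|\mathcal{G}}(\cdot|\omega)$ is the set-valued quantile mapping of $\mathbb{P}_{X|\mathcal{G}}(\cdot,\omega)$. The set-valued center-outward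 distribution map is $\mathbb{F}_{X|\mathcal{G}}(y,\omega)=\{u\in\mathbb{B}^d: y\in\mathbb{Q}_{X|\mathcal{G}}(u|\omega)\}$. Prediction objects: $\mathbb{Q}_{t+1|t}=\mathbb{Q}_{X_{t+1}|\mathcal{F}_{\le t}}$, $\mathbb{F}_{t+1|t}=\mathbb{F}_{X_{t+1}|\mathcal{F}_{\le t}}$, and $\mathcal{R}_{t+1|t}(\tau|\omega)=\bigcup_{\|u\|\le\tau}\mathbb{Q}_{t+1|t}(u|\omega)$. *)

theory Defs
  imports "HOL-Probability.Probability"
begin

(* The normalized surface measure of the unit sphere, as the law of Z / |Z| for Z uniform on the
   unit ball; it is the rotation-invariant probability measure on the sphere.  In dimension 1 it
   puts mass 1/2 on each of -1 and 1. *)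
definition sphere_uniform :: "'a::euclidean_space measure" where
  "sphere_uniform = distr (uniform_measure lborel (ball 0 1)) borel (\<lambda>x. x /\<^sub>R norm x)"

(* The law of R * S with R uniform on [0,1] and S uniform on the unit sphere, independent.  It is
   a Borel measure on the whole space, carried by the closed (and, up to a null set, open) unit ball. *)
definition spherical_uniform :: "'a::euclidean_space measure" where
  "spherical_uniform =
     distr (uniform_measure lborel {0..1::real} \<Otimes>\<^sub>M sphere_uniform) borel (\<lambda>(r, s). r *\<^sub>R s)"

definition subdifferential :: "('a::euclidean_space \<Rightarrow> real) \<Rightarrow> 'a \<Rightarrow> 'a set" where
  "subdifferential \<phi> u = {x. \<forall>v\<in>ball 0 1. \<phi> v \<ge> \<phi> u + inner x (v - u)}"

(* Only the values of \<phi> on the open unit ball matter.  G is a Borel version of the a.e. defined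
   gradient of \<phi>. *)
definition quantile_potential :: "'a::euclidean_space measure \<Rightarrow> ('a \<Rightarrow> real) \<Rightarrow> bool" where
  "quantile_potential \<nu> \<phi> \<longleftrightarrow>
     convex_on (ball 0 1) \<phi> \<and>
     (\<exists>G\<in>borel_measurable borel.
        (AE u in spherical_uniform. GDERIV \<phi> u :> G u) \<and> distr spherical_uniform borel G = \<nu>)"

(* Q is the set-valued quantile map of \<nu>, stated as a relation: by McCann's theorem a potential
   exists and is unique up to an additive constant, which does not affect the subdifferential.
   Q is constrained on the open unit ball only. *)
definition is_quantile_map :: "'a::euclidean_space measure \<Rightarrow> ('a \<Rightarrow> 'a set) \<Rightarrow> bool" where
  "is_quantile_map \<nu> Q \<longleftrightarrow>
     (\<exists>\<phi>. quantile_potential \<nu> \<phi> \<and> (\<forall>u\<in>ball 0 1. Q u = subdifferential \<phi> u))"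

definition distribution_map :: "('a::euclidean_space \<Rightarrow> 'a set) \<Rightarrow> 'a \<Rightarrow> 'a set" where
  "distribution_map Q y = {u \<in> ball 0 1. y \<in> Q u}"

definition quantile_region :: "('a::euclidean_space \<Rightarrow> 'a set) \<Rightarrow> real \<Rightarrow> 'a set" where
  "quantile_region Q \<tau> = (\<Union>u\<in>cball 0 \<tau>. Q u)"

(* K ranges over all versions of the conditional distribution; each K \<omega> is a Borel probability
   measure, depending G-measurably on \<omega>. *)
definition is_regular_cond_distr ::
  "'w measure \<Rightarrow> 'w measure \<Rightarrow> ('w \<Rightarrow> 'a::euclidean_space) \<Rightarrow> ('w \<Rightarrow> 'a measure) \<Rightarrow> bool" where
  "is_regular_cond_distr M G Y K \<longleftrightarrow>
     K \<in> measurable G (prob_algebra borel) \<and>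
     (\<forall>B\<in>sets borel.
        AE \<omega> in M. measure (K \<omega>) B = real_cond_exp M G (indicator (Y -` B \<inter> space M)) \<omega>)"

definition is_cond_quantile_map ::
  "'w measure \<Rightarrow> ('w \<Rightarrow> 'a::euclidean_space measure) \<Rightarrow> ('w \<Rightarrow> 'a \<Rightarrow> 'a set) \<Rightarrow> bool" where
  "is_cond_quantile_map M K Q \<longleftrightarrow> (\<forall>\<omega>\<in>space M. is_quantile_map (K \<omega>) (Q \<omega>))"

definition past_sigma :: "'w measure \<Rightarrow> (int \<Rightarrow> 'w \<Rightarrow> 'a::euclidean_space) \<Rightarrow> int \<Rightarrow> 'w measure" where
  "past_sigma M X t = sigma (space M) (\<Union>s\<in>{..t}. {X s -` B \<inter> space M | B. B \<in> sets borel})"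

end

theory Submission
  imports Defs "HOL-Complex_Analysis.Great_Picard"
begin

text \<open>The delicate point is measurability, because the potentials are given separately for every
  \<open>\<omega>\<close>.  It follows from a stability property: if the conditional distributions converge on a
  countable family of open sets that separates compact sets from closed sets, then limits of points
  of the regions lie in the limiting region.  Tightness and monotonicity bound the subgradients
  locally uniformly, so a subsequence of the normalised potentials converges on the unit ball; the
  subdifferential of the limit carries the limiting distribution, and Aleksandrov's lemma in McCann's
  form then shows that it meets, hence equals, the subdifferential of the given potential.

  The conditional probability is then the mass that the conditional distribution gives to the
  region.  It is at least \<open>\<tau>\<close> because the gradient maps the ball of radius \<open>\<tau>\<close>, which has mass \<open>\<tau>\<close>, into
  the region.  It exceeds \<open>\<tau>\<close> only through points that are subgradients at two different places;
  there the conjugate potential is not differentiable, so these points form a Lebesgue null set.\<close>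

section \<open>Subdifferentials of convex functions on the unit ball\<close>

text \<open>Nothing ties the potentials at different \<open>\<omega>\<close> together: they come
  from a separate choice for each \<open>\<omega>\<close>, so measurability can be drawn only from
  the measures \<open>K \<omega>\<close>. The stability argument may therefore assume no more than
  convergence of countably many masses. This yields a one-sided statement about a limit
  \<open>\<psi>\<close> of potentials: the limiting mass of a compact set is at most the
  \<open>spherical_uniform\<close> mass of the points where \<open>\<psi>\<close> has a subgradient
  in that set. The uniqueness lemma \<open>subdifferentials_meet\<close> is shaped to accept exactly
  such an inequality, so that \<open>\<psi>\<close> never has to be differentiated. Two facts about
  the reference measure carry the argument: nonempty open subsets of the unit ball have positive
  mass, which drives tightness bounds and uniqueness, and the closed ball of radius
  \<open>\<tau>\<close> has mass \<open>\<tau>\<close>, which fixes the level.\<close>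

lemma subdifferentialD:
  "x \<in> subdifferential \<phi> u \<Longrightarrow> v \<in> ball 0 1 \<Longrightarrow> \<phi> v \<ge> \<phi> u + inner x (v - u)"
  by (auto simp: subdifferential_def)

lemma subdifferentialI:
  "(\<And>v. v \<in> ball 0 1 \<Longrightarrow> \<phi> v \<ge> \<phi> u + inner x (v - u)) \<Longrightarrow> x \<in> subdifferential \<phi> u"
  by (auto simp: subdifferential_def)

lemma subdifferential_monotone:
  assumes "x \<in> subdifferential \<phi> u" "y \<in> subdifferential \<phi> v" "u \<in> ball 0 1" "v \<in> ball 0 1"
  shows "inner (x - y) (u - v) \<ge> 0"
  using subdifferentialD[OF assms(1,4)] subdifferentialD[OF assms(2,3)]
  by (simp add: inner_diff_left inner_diff_right)

lemma subdifferential_add_const: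
  assumes "\<And>v. v \<in> ball 0 1 \<Longrightarrow> \<phi> v = \<psi> v + c" "u \<in> ball 0 1"
  shows "subdifferential \<phi> u = subdifferential \<psi> u"
  using assms by (auto simp: subdifferential_def)

text \<open>A hyperplane separates the strict epigraph from the point \<open>(u, f u)\<close>. It
  cannot be vertical, because \<open>S\<close> is open and leaves room to step from \<open>u\<close>
  along \<open>\<alpha>\<close>; dividing by \<open>- \<beta>\<close> turns its normal into a
  slope.\<close>

lemma convex_on_imp_subgradient:
  fixes f :: "'a::euclidean_space \<Rightarrow> real"
  assumes f: "convex_on S f" and S: "open S" and u: "u \<in> S"
  obtains x where "\<And>v. v \<in> S \<Longrightarrow> f v \<ge> f u + inner x (v - u)"
proof -
  let ?E = "{p :: 'a \<times> real. fst p \<in> S \<and> snd p > f (fst p)}"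
  have cS: "convex S" using f by (simp add: convex_on_def)
  have cE: "convex ?E"
  proof (rule convexI, clarsimp)
    fix v y w z a b assume *: "v \<in> S" "w \<in> S" "f v < y" "f w < z" "0 \<le> (a::real)" "0 \<le> b" "a + b = 1"
    have "a *\<^sub>R v + b *\<^sub>R w \<in> S" using cS * by (simp add: convex_def)
    moreover have "f (a *\<^sub>R v + b *\<^sub>R w) \<le> a * f v + b * f w"
      using f * by (auto simp: convex_on_def)
    moreover have "a * f v + b * f w < a * y + b * z"
    proof (cases "a = 0")
      case False
      then have "a * f v < a * y" "b * f w \<le> b * z" using * by (auto intro: mult_left_mono)
      then show ?thesis by simp
    qed (use * in auto)
    ultimately show "a *\<^sub>R v + b *\<^sub>R w \<in> S \<and> f (a *\<^sub>R v + b *\<^sub>R w) < a * y + b * z" by auto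
  qed
  have "(u, f u + 1) \<in> ?E" using u by simp
  then have ne: "?E \<noteq> {}" by blast
  obtain A b where A: "A \<noteq> 0" "\<forall>p\<in>?E. inner A p \<le> b" "\<forall>p\<in>{(u, f u)}. inner A p \<ge> b"
    using separating_hyperplane_sets[OF cE, of "{(u, f u)}"] ne by (metis (no_types, lifting) Int_insert_right_if0 Int_empty_right convex_singleton insert_not_empty less_irrefl mem_Collect_eq fst_conv snd_conv)
  obtain \<alpha> \<beta> where [simp]: "A = (\<alpha>, \<beta>)" by (cases A)
  have le: "inner \<alpha> v + \<beta> * y \<le> inner \<alpha> u + \<beta> * f u" if "v \<in> S" "y > f v" for v y
    using A(2)[rule_format, of "(v, y)"] A(3) that by simp
  have le': "inner \<alpha> v + \<beta> * f v \<le> inner \<alpha> u + \<beta> * f u" if "v \<in> S" for v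
  proof (rule tendsto_upperbound)
    show "((\<lambda>y. inner \<alpha> v + \<beta> * y) \<longlongrightarrow> inner \<alpha> v + \<beta> * f v) (at_right (f v))"
      by (intro tendsto_intros)
    show "\<forall>\<^sub>F y in at_right (f v). inner \<alpha> v + \<beta> * y \<le> inner \<alpha> u + \<beta> * f u"
      using le[OF that] by (auto intro: eventually_at_right_less eventually_mono)
  qed simp
  have "\<beta> \<le> 0" using le[OF u, of "f u + 1"] by (simp add: algebra_simps)
  moreover have "\<beta> \<noteq> 0"
  proof
    assume b0: "\<beta> = 0"
    obtain e where e: "e > 0" "ball u e \<subseteq> S" using S u openE by blast
    have "\<alpha> \<noteq> 0" using A(1) b0 by (auto simp: zero_prod_def)
    let ?v = "u + (e / 2 / norm \<alpha>) *\<^sub>R \<alpha>"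
    have "?v \<in> ball u e" using e \<open>\<alpha> \<noteq> 0\<close> by (simp add: dist_norm)
    then have "inner \<alpha> ?v \<le> inner \<alpha> u" using le'[of ?v] e b0 by auto
    moreover have "inner \<alpha> ((e / 2 / norm \<alpha>) *\<^sub>R \<alpha>) > 0" using e \<open>\<alpha> \<noteq> 0\<close> by simp
    ultimately show False by (simp add: inner_add_right)
  qed
  ultimately have neg: "\<beta> < 0" by simp
  have "f v \<ge> f u + inner ((1 / - \<beta>) *\<^sub>R \<alpha>) (v - u)" if "v \<in> S" for v
    using le'[OF that] neg by (simp add: field_simps inner_diff_right)
  then show ?thesis by (rule that)
qed

lemma subdifferential_nonempty:
  assumes "convex_on (ball 0 1) \<phi>" "u \<in> ball 0 1"
  shows "subdifferential \<phi> u \<noteq> {}"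
  by (rule convex_on_imp_subgradient[OF assms(1) open_ball assms(2)]) (use subdifferentialI in blast)

text \<open>Along the segment to \<open>v\<close>, convexity bounds every difference quotient with
  step below 1 by \<open>\<phi> v - \<phi> u\<close>; the quotients tend to the directional
  derivative.\<close>

lemma gradient_in_subdifferential:
  fixes \<phi> :: "'a::euclidean_space \<Rightarrow> real"
  assumes \<phi>: "convex_on (ball 0 1) \<phi>" and u: "u \<in> ball 0 1" and G: "GDERIV \<phi> u :> G"
  shows "G \<in> subdifferential \<phi> u"
proof (rule subdifferentialI)
  fix v :: 'a assume v: "v \<in> ball 0 1"
  have "((\<lambda>s::real. u + s *\<^sub>R (v - u)) has_derivative (\<lambda>s. s *\<^sub>R (v - u))) (at 0)"
    by (auto intro!: derivative_eq_intros)
  then have "((\<lambda>s::real. \<phi> (u + s *\<^sub>R (v - u))) has_derivative (\<lambda>s. inner (s *\<^sub>R (v - u)) G)) (at 0)"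
    using has_derivative_compose[of "\<lambda>s::real. u + s *\<^sub>R (v - u)" "\<lambda>s. s *\<^sub>R (v - u)" 0 UNIV \<phi> "\<lambda>h. inner h G"] G
    by (simp add: gderiv_def)
  then have "((\<lambda>s::real. \<phi> (u + s *\<^sub>R (v - u))) has_field_derivative inner (v - u) G) (at 0)"
    unfolding has_field_derivative_def by (simp add: mult_commute_abs)
  then have "((\<lambda>s::real. (\<phi> (u + s *\<^sub>R (v - u)) - \<phi> u) / s) \<longlongrightarrow> inner (v - u) G) (at_right 0)"
    by (auto simp: has_field_derivative_iff dest: tendsto_within_subset[OF _ subset_UNIV])
  moreover have "\<forall>\<^sub>F s in at_right (0::real). (\<phi> (u + s *\<^sub>R (v - u)) - \<phi> u) / s \<le> \<phi> v - \<phi> u"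
    unfolding eventually_at_right_field
  proof (intro exI[of _ 1] conjI allI impI)
    fix s :: real assume s: "0 < s" "s < 1"
    have "\<phi> ((1 - s) *\<^sub>R u + s *\<^sub>R v) \<le> (1 - s) * \<phi> u + s * \<phi> v"
      using convex_onD[OF \<phi>, of s u v] s u v by simp
    moreover have "(1 - s) *\<^sub>R u + s *\<^sub>R v = u + s *\<^sub>R (v - u)" by (simp add: algebra_simps)
    ultimately show "(\<phi> (u + s *\<^sub>R (v - u)) - \<phi> u) / s \<le> \<phi> v - \<phi> u"
      using s by (simp add: field_simps)
  qed simp
  ultimately have "inner (v - u) G \<le> \<phi> v - \<phi> u"
    by (intro tendsto_upperbound) auto
  then show "\<phi> v \<ge> \<phi> u + inner G (v - u)" by (simp add: inner_commute)
qed

text \<open>A convex function that lies above an affine one near \<open>p\<close>, with equality at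
  \<open>p\<close>, lies above it along every segment from \<open>p\<close>.\<close>

lemma local_subgradient:
  fixes \<phi> :: "'a::euclidean_space \<Rightarrow> real"
  assumes \<phi>: "convex_on (ball 0 1) \<phi>" and p: "p \<in> ball 0 1" and e: "e > 0"
    and loc: "\<And>v. v \<in> ball 0 1 \<Longrightarrow> v \<in> ball p e \<Longrightarrow> \<phi> v \<ge> \<phi> p + inner x (v - p)"
  shows "x \<in> subdifferential \<phi> p"
proof (rule subdifferentialI)
  fix v :: 'a assume v: "v \<in> ball 0 1"
  \<comment> \<open>Small enough that the point at parameter \<open>s\<close> on the segment from
    \<open>p\<close> to \<open>v\<close> stays within \<open>e\<close> of \<open>p\<close>; the
    added 1 covers \<open>v = p\<close>.\<close>
  define s where "s = min 1 (e / (2 * (norm (v - p) + 1)))"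
  have s: "0 < s" "s \<le> 1" using e by (auto simp: s_def add_nonneg_pos)
  let ?w = "(1 - s) *\<^sub>R p + s *\<^sub>R v"
  have w: "?w \<in> ball 0 1" using convexD_alt[OF convex_ball p v] s by simp
  have wp: "?w - p = s *\<^sub>R (v - p)" by (simp add: algebra_simps)
  have "s * norm (v - p) \<le> e / (2 * (norm (v - p) + 1)) * norm (v - p)"
    by (intro mult_right_mono) (auto simp: s_def)
  also have "\<dots> = e * (norm (v - p) / (2 * (norm (v - p) + 1)))" by simp
  finally have le: "s * norm (v - p) \<le> e * (norm (v - p) / (2 * (norm (v - p) + 1)))" .
  have "norm (v - p) / (2 * (norm (v - p) + 1)) < 1"
  proof (subst pos_divide_less_eq)
    show "0 < 2 * (norm (v - p) + 1)" "norm (v - p) < 1 * (2 * (norm (v - p) + 1))"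
      using norm_ge_zero[of "v - p"] by argo+
  qed
  then have "e * (norm (v - p) / (2 * (norm (v - p) + 1))) < e * 1"
    using e by (intro mult_strict_left_mono)
  with le have "s * norm (v - p) < e" by simp
  then have "?w \<in> ball p e" using s wp by (simp add: dist_norm norm_minus_commute[of p])
  then have "\<phi> p + inner x (?w - p) \<le> \<phi> ?w" using w loc by blast
  also have "\<dots> \<le> (1 - s) * \<phi> p + s * \<phi> v" using convex_onD[OF \<phi>, of s p v] s p v by simp
  finally have "s * inner x (v - p) \<le> s * (\<phi> v - \<phi> p)" by (simp add: wp algebra_simps)
  then show "\<phi> v \<ge> \<phi> p + inner x (v - p)" using s by simp
qed

text \<open>A step of length \<open>d\<close> from \<open>u\<close> in the direction of
  \<open>x\<close> raises \<open>\<phi>\<close> by at least \<open>d * norm x\<close>, while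
  \<open>\<phi>\<close> is bounded on the slightly larger closed ball.\<close>

lemma subdifferential_bounded_on_cball:
  fixes \<phi> :: "'a::euclidean_space \<Rightarrow> real"
  assumes \<phi>: "convex_on (ball 0 1) \<phi>" and r: "r < 1"
  obtains L where "\<And>u x. u \<in> cball 0 r \<Longrightarrow> x \<in> subdifferential \<phi> u \<Longrightarrow> norm x \<le> L"
proof -
  define d where "d = (1 - r) / 2"
  have d: "d > 0" "r + d < 1" using r by (auto simp: d_def field_simps)
  have "continuous_on (cball 0 (r + d)) \<phi>"
    by (rule continuous_on_subset[OF convex_on_continuous[OF open_ball \<phi>]]) (use d in auto)
  then have "bounded (\<phi> ` cball 0 (r + d))"
    by (intro compact_imp_bounded compact_continuous_image) auto
  then obtain B where B: "\<And>v. v \<in> cball 0 (r + d) \<Longrightarrow> \<bar>\<phi> v\<bar> \<le> B"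
    unfolding bounded_iff real_norm_def by blast
  show ?thesis
  proof (rule that[of "2 * B / d"])
    fix u x assume u: "u \<in> cball 0 r" and x: "x \<in> subdifferential \<phi> u"
    \<comment> \<open>For \<open>x = 0\<close> the quotient is 0 by convention, so \<open>?v\<close>
      is \<open>u\<close> and the estimates remain valid.\<close>
    let ?v = "u + (d / norm x) *\<^sub>R x"
    have "norm ?v \<le> norm u + norm ((d / norm x) *\<^sub>R x)" by (rule norm_triangle_ineq)
    also have "\<dots> \<le> r + d" using u d by (intro add_mono) (auto simp: divide_simps)
    finally have v: "?v \<in> cball 0 (r + d)" by simp
    then have "\<phi> u + inner x (?v - u) \<le> \<phi> ?v" using d by (intro subdifferentialD[OF x]) auto
    moreover have "inner x (?v - u) = d * norm x"
      by (simp add: power2_norm_eq_inner[symmetric] power2_eq_square)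
    moreover have "u \<in> cball 0 (r + d)" using u d by auto
    ultimately have "\<phi> u + d * norm x \<le> \<phi> ?v" "\<bar>\<phi> u\<bar> \<le> B" using B by auto
    then have "d * norm x \<le> 2 * B" using B[OF v] by argo
    then show "norm x \<le> 2 * B / d" using d by (simp add: field_simps)
  qed
qed

text \<open>Convergence at the moving points \<open>u n\<close> is a separate hypothesis because
  pointwise convergence does not give it; it comes from continuity for one potential and from a
  common Lipschitz bound for a sequence.\<close>

lemma subdifferential_limit:
  fixes \<phi> :: "nat \<Rightarrow> 'a::euclidean_space \<Rightarrow> real"
  assumes "\<And>v. v \<in> ball 0 1 \<Longrightarrow> (\<lambda>n. \<phi> n v) \<longlonglongrightarrow> \<psi> v" "(\<lambda>n. \<phi> n (u n)) \<longlonglongrightarrow> \<psi> l"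
    "u \<longlonglongrightarrow> l" "x \<longlonglongrightarrow> y" "\<And>n. x n \<in> subdifferential (\<phi> n) (u n)"
  shows "y \<in> subdifferential \<psi> l"
proof (rule subdifferentialI)
  fix v :: 'a assume v: "v \<in> ball 0 1"
  have "(\<lambda>n. \<phi> n (u n) + inner (x n) (v - u n)) \<longlonglongrightarrow> \<psi> l + inner y (v - l)"
    by (intro tendsto_intros assms)
  then show "\<psi> l + inner y (v - l) \<le> \<psi> v"
    using assms(1)[OF v] subdifferentialD[OF assms(5) v]
    by (intro LIMSEQ_le[of "\<lambda>n. \<phi> n (u n) + inner (x n) (v - u n)"]) auto
qed

lemma subdifferential_closed_graph:
  fixes \<phi> :: "'a::euclidean_space \<Rightarrow> real"
  assumes \<phi>: "convex_on (ball 0 1) \<phi>" and "u \<longlonglongrightarrow> l" "x \<longlonglongrightarrow> y" "l \<in> ball 0 1"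
    "\<And>n. x n \<in> subdifferential \<phi> (u n)"
  shows "y \<in> subdifferential \<phi> l"
proof (rule subdifferential_limit[of "\<lambda>_. \<phi>"])
  have "isCont \<phi> l" using convex_on_continuous[OF open_ball \<phi>] assms(4)
    by (simp add: continuous_on_eq_continuous_at)
  then show "(\<lambda>n. \<phi> (u n)) \<longlonglongrightarrow> \<phi> l" using assms(2) by (rule isCont_tendsto_compose)
qed (use assms in auto)

lemma subdifferential_seq_compact:
  fixes \<phi> :: "'a::euclidean_space \<Rightarrow> real"
  assumes \<phi>: "convex_on (ball 0 1) \<phi>" and r: "r < 1"
    and ux: "\<And>n. u n \<in> cball 0 r \<and> x n \<in> subdifferential \<phi> (u n)"
  obtains l y k where "l \<in> cball 0 r" "y \<in> subdifferential \<phi> l" "strict_mono (k::nat \<Rightarrow> nat)"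
    "(u \<circ> k) \<longlonglongrightarrow> l" "(x \<circ> k) \<longlonglongrightarrow> y"
proof -
  obtain L where L: "\<And>u x. u \<in> cball 0 r \<Longrightarrow> x \<in> subdifferential \<phi> u \<Longrightarrow> norm x \<le> L"
    using subdifferential_bounded_on_cball[OF \<phi> r] by blast
  have "seq_compact (cball (0::'a) r \<times> cball (0::'a) L)"
    by (rule compact_imp_seq_compact[OF compact_Times[OF compact_cball compact_cball]])
  moreover have "\<forall>n. (u n, x n) \<in> cball 0 r \<times> cball 0 L" using ux L by auto
  ultimately obtain q k where q: "q \<in> cball 0 r \<times> cball 0 L" "strict_mono (k::nat \<Rightarrow> nat)"
    "((\<lambda>n. (u n, x n)) \<circ> k) \<longlonglongrightarrow> q"
    by (rule seq_compactE)
  have lim: "(u \<circ> k) \<longlonglongrightarrow> fst q" "(x \<circ> k) \<longlonglongrightarrow> snd q"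
    using tendsto_fst[OF q(3)] tendsto_snd[OF q(3)] by (auto simp: o_def)
  have fq: "fst q \<in> ball 0 1" "fst q \<in> cball 0 r" using q(1) r by auto
  have "snd q \<in> subdifferential \<phi> (fst q)"
    by (rule subdifferential_closed_graph[OF \<phi> lim fq(1)]) (simp add: ux)
  then show ?thesis by (rule that[OF fq(2) _ q(2) lim])
qed

section \<open>Compact images and Borel preimages under the subdifferential\<close>

lemma compact_subset_cball:
  fixes C :: "'a::euclidean_space set"
  assumes "compact C" "C \<subseteq> ball 0 1"
  obtains r where "r < 1" "C \<subseteq> cball 0 r"
proof (cases "C = {}")
  case False
  then obtain c where c: "c \<in> C" "\<And>y. y \<in> C \<Longrightarrow> norm y \<le> norm c"
    using continuous_attains_sup[OF assms(1), of norm] by (auto intro: continuous_intros)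
  then show ?thesis using assms(2) by (intro that[of "norm c"]) auto
qed (use that[of 0] in auto)

lemma compact_subdifferential_image:
  fixes \<phi> :: "'a::euclidean_space \<Rightarrow> real"
  assumes \<phi>: "convex_on (ball 0 1) \<phi>" and C: "compact C" "C \<subseteq> ball 0 1"
  shows "compact (\<Union>u\<in>C. subdifferential \<phi> u)"
  unfolding compact_eq_seq_compact_metric seq_compact_def
proof (intro allI impI)
  fix x :: "nat \<Rightarrow> 'a" assume "\<forall>n. x n \<in> (\<Union>u\<in>C. subdifferential \<phi> u)"
  then obtain u where u: "\<And>n. u n \<in> C \<and> x n \<in> subdifferential \<phi> (u n)" by simp metis
  obtain r where r: "r < 1" "C \<subseteq> cball 0 r" using compact_subset_cball[OF C] by blast
  then obtain l y k where k: "l \<in> cball 0 r" "y \<in> subdifferential \<phi> l" "strict_mono (k::nat \<Rightarrow> nat)"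
    "(u \<circ> k) \<longlonglongrightarrow> l" "(x \<circ> k) \<longlonglongrightarrow> y"
    using subdifferential_seq_compact[OF \<phi> r(1), of u x] u by blast
  have "l \<in> C" using closed_sequentially[OF compact_imp_closed[OF C(1)], of "u \<circ> k" l] u k by auto
  then show "\<exists>l\<in>\<Union>u\<in>C. subdifferential \<phi> u. \<exists>r. strict_mono r \<and> (x \<circ> r) \<longlonglongrightarrow> l"
    using k by auto
qed

text \<open>The set is a countable union of closed sets: over each closed ball of radius below 1 the
  subgradients are bounded, so limits of points with a subgradient in \<open>C\<close> again have
  one.\<close>

lemma subdifferential_preimage_borel:
  fixes \<phi> :: "'a::euclidean_space \<Rightarrow> real"
  assumes \<phi>: "convex_on (ball 0 1) \<phi>" and C: "closed C"
  shows "{u \<in> ball 0 1. subdifferential \<phi> u \<inter> C \<noteq> {}} \<in> sets borel"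
proof -
  let ?A = "\<lambda>n. {u \<in> cball 0 (1 - 1 / real (Suc n)). subdifferential \<phi> u \<inter> C \<noteq> {}}"
  have "closed (?A n)" for n
    unfolding closed_sequential_limits
  proof (intro allI impI, elim conjE)
    fix u l assume u: "\<forall>i. u i \<in> ?A n" "u \<longlonglongrightarrow> l"
    then have "\<forall>i. \<exists>x. x \<in> subdifferential \<phi> (u i) \<inter> C" by blast
    then obtain x where x: "\<And>i. x i \<in> subdifferential \<phi> (u i) \<inter> C" by metis
    have r: "1 - 1 / real (Suc n) < 1" by simp
    obtain m y k where k: "m \<in> cball 0 (1 - 1 / real (Suc n))" "y \<in> subdifferential \<phi> m"
      "strict_mono (k::nat \<Rightarrow> nat)" "(u \<circ> k) \<longlonglongrightarrow> m" "(x \<circ> k) \<longlonglongrightarrow> y"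
      by (rule subdifferential_seq_compact[OF \<phi> r, of u x]) (use u x in auto)
    have "m = l" using k(4) LIMSEQ_subseq_LIMSEQ[OF u(2) k(3)] LIMSEQ_unique by blast
    moreover have "y \<in> C" using closed_sequentially[OF C, of "x \<circ> k" y] x k by auto
    ultimately show "l \<in> ?A n" using k by auto
  qed
  moreover have "{u \<in> ball 0 1. subdifferential \<phi> u \<inter> C \<noteq> {}} = (\<Union>n. ?A n)"
  proof (intro equalityI subsetI)
    fix u assume u: "u \<in> {u \<in> ball 0 1. subdifferential \<phi> u \<inter> C \<noteq> {}}"
    then have "0 < 1 - norm u" by simp
    then obtain n where "inverse (real (Suc n)) < 1 - norm u" using reals_Archimedean by blast
    then have "u \<in> ?A n" using u by (simp add: field_simps)
    then show "u \<in> (\<Union>n. ?A n)" by blast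
  next
    fix u assume "u \<in> (\<Union>n. ?A n)"
    then obtain n where n: "norm u \<le> 1 - 1 / real (Suc n)" "subdifferential \<phi> u \<inter> C \<noteq> {}" by auto
    moreover have "1 / real (Suc n) > 0" by simp
    ultimately have "norm u < 1" by linarith
    then show "u \<in> {u \<in> ball 0 1. subdifferential \<phi> u \<inter> C \<noteq> {}}" using n by simp
  qed
  ultimately show ?thesis by (auto intro: borel_closed)
qed

text \<open>Chopping the segment from \<open>p\<close> to \<open>q\<close> into \<open>N\<close> pieces and using a common subgradient at each
  division point bounds the difference of the increments by \<open>O(1/N)\<close>.\<close>
lemma common_subgradients_increment_le:
  fixes \<phi> \<psi> :: "'a::euclidean_space \<Rightarrow> real"
  assumes meet: "\<And>u. u \<in> ball 0 1 \<Longrightarrow> subdifferential \<phi> u \<inter> subdifferential \<psi> u \<noteq> {}"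
    and pq: "p \<in> ball 0 1" "q \<in> ball 0 1"
  shows "\<psi> q - \<psi> p \<le> \<phi> q - \<phi> p"
proof -
  define h where "h = q - p"
  define y where "y s = (SOME x. x \<in> subdifferential \<phi> (p + s *\<^sub>R h) \<inter> subdifferential \<psi> (p + s *\<^sub>R h))" for s
  have inb: "p + s *\<^sub>R h \<in> ball 0 1" if "0 \<le> s" "s \<le> 1" for s
  proof -
    have "(1 - s) *\<^sub>R p + s *\<^sub>R q \<in> ball 0 1"
      using convexD_alt[OF convex_ball pq] that by simp
    then show ?thesis by (simp add: h_def algebra_simps)
  qed
  have y: "y s \<in> subdifferential \<phi> (p + s *\<^sub>R h)" "y s \<in> subdifferential \<psi> (p + s *\<^sub>R h)" if "0 \<le> s" "s \<le> 1" for s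
    using someI_ex[of "\<lambda>x. x \<in> subdifferential \<phi> (p + s *\<^sub>R h) \<inter> subdifferential \<psi> (p + s *\<^sub>R h)"]
      meet[OF inb[OF that]] unfolding y_def by auto
  let ?D = "\<lambda>s. \<psi> (p + s *\<^sub>R h) - \<phi> (p + s *\<^sub>R h)"
  \<comment> \<open>Adds the inequality for \<open>\<phi>\<close> based at \<open>s\<close> to the
    one for \<open>\<psi>\<close> based at \<open>t\<close>. The slopes come from one selection
    \<open>y\<close>, so on an equal partition their differences telescope to the two end
    slopes.\<close>
  have step: "?D t - ?D s \<le> (t - s) * (inner (y t) h - inner (y s) h)"
    if "0 \<le> s" "s \<le> 1" "0 \<le> t" "t \<le> 1" for s t
    using subdifferentialD[OF y(1)[OF that(1,2)] inb[OF that(3,4)]]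
      subdifferentialD[OF y(2)[OF that(3,4)] inb[OF that(1,2)]]
    by (simp add: left_diff_distrib right_diff_distrib scaleR_left_diff_distrib[symmetric])
  have bnd: "?D 1 - ?D 0 \<le> (inner (y 1) h - inner (y 0) h) / real (Suc N)" for N
  proof -
    let ?s = "\<lambda>i. real i / real (Suc N)"
    have "?D 1 - ?D 0 = (\<Sum>i<Suc N. ?D (?s (Suc i)) - ?D (?s i))"
      by (subst sum_lessThan_telescope) simp
    also have "\<dots> \<le> (\<Sum>i<Suc N. (1 / real (Suc N)) * (inner (y (?s (Suc i))) h - inner (y (?s i)) h))"
    proof (rule sum_mono)
      fix i assume i: "i \<in> {..<Suc N}"
      have "?s (Suc i) - ?s i = 1 / real (Suc N)" by (simp add: diff_divide_distrib[symmetric])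
      then show "?D (?s (Suc i)) - ?D (?s i)
          \<le> (1 / real (Suc N)) * (inner (y (?s (Suc i))) h - inner (y (?s i)) h)"
        using step[of "?s i" "?s (Suc i)"] i by simp
    qed
    also have "\<dots> = (1 / real (Suc N)) * (inner (y 1) h - inner (y 0) h)"
      by (subst sum_distrib_left[symmetric], subst sum_lessThan_telescope) simp
    finally show ?thesis by simp
  qed
  have "(\<lambda>N. (inner (y 1) h - inner (y 0) h) / real (Suc N)) \<longlonglongrightarrow> 0"
    using LIMSEQ_Suc[OF lim_const_over_n[of "inner (y 1) h - inner (y 0) h"]] by simp
  then have "?D 1 - ?D 0 \<le> 0"
    using bnd by (intro LIMSEQ_le_const) auto
  then show ?thesis by (simp add: h_def)
qed

text \<open>Since the hypothesis is symmetric, the increment inequality holds both ways, and the two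
  potentials differ by a constant.\<close>

lemma subdifferential_eq_if_meet:
  fixes \<phi> \<psi> :: "'a::euclidean_space \<Rightarrow> real"
  assumes meet: "\<And>u. u \<in> ball 0 1 \<Longrightarrow> subdifferential \<phi> u \<inter> subdifferential \<psi> u \<noteq> {}"
    and u: "u \<in> ball 0 1"
  shows "subdifferential \<phi> u = subdifferential \<psi> u"
proof (rule subdifferential_add_const[OF _ u, of _ _ "\<phi> 0 - \<psi> 0"])
  fix v :: 'a assume "v \<in> ball 0 1"
  then show "\<phi> v = \<psi> v + (\<phi> 0 - \<psi> 0)"
    using common_subgradients_increment_le[of \<phi> \<psi> 0 v] common_subgradients_increment_le[of \<psi> \<phi> 0 v] meet
    by (simp add: Int_commute)
qed

section \<open>The spherical uniform distribution\<close>

lemma emeasure_lborel_pos_open: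
  fixes U :: "'a::euclidean_space set"
  assumes "open U" "U \<noteq> {}"
  shows "emeasure lborel U > 0"
proof (rule ccontr)
  assume "\<not> emeasure lborel U > 0"
  then have "U \<in> null_sets lebesgue" using assms(1) by (auto simp: null_sets_def)
  then show False using open_not_negligible[OF assms] by (simp add: negligible_iff_null_sets)
qed

lemma ball_probability:
  shows "emeasure lborel (ball (0::'a::euclidean_space) 1) \<noteq> 0"
    "emeasure lborel (ball (0::'a) 1) \<noteq> \<infinity>"
proof -
  show "emeasure lborel (ball (0::'a) 1) \<noteq> 0"
    using emeasure_lborel_pos_open[of "ball (0::'a) 1"] by auto
  show "emeasure lborel (ball (0::'a) 1) \<noteq> \<infinity>"
    using emeasure_bounded_finite[of "ball (0::'a) 1"] by auto
qed

lemma prob_space_sphere_uniform: "prob_space (sphere_uniform :: 'a::euclidean_space measure)"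
  unfolding sphere_uniform_def
  by (intro prob_space.prob_space_distr prob_space_uniform_measure ball_probability) simp

lemma sets_sphere_uniform [simp, measurable_cong]:
  "sets (sphere_uniform :: 'a::euclidean_space measure) = sets borel"
  by (simp add: sphere_uniform_def)

lemma sets_spherical_uniform [simp, measurable_cong]:
  "sets (spherical_uniform :: 'a::euclidean_space measure) = sets borel"
  by (simp add: spherical_uniform_def)

lemma space_spherical_uniform [simp]: "space (spherical_uniform :: 'a::euclidean_space measure) = UNIV"
  by (simp add: spherical_uniform_def)

lemma prob_space_unit_interval: "prob_space (uniform_measure lborel {0..1::real})"
  by (intro prob_space_uniform_measure) auto

text \<open>Only the origin is sent off the sphere by \<open>x /\<^sub>R norm x\<close>, and it is a
  Lebesgue null set.\<close>

lemma AE_sphere_uniform: "AE s in (sphere_uniform :: 'a::euclidean_space measure). norm s = 1"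
proof -
  have "AE x in lborel. x \<in> ball (0::'a) 1 \<longrightarrow> norm (x /\<^sub>R norm x) = 1"
    using AE_lborel_singleton[of "0::'a"] by (rule AE_mp) (auto intro!: AE_I2)
  then have "AE x in uniform_measure lborel (ball (0::'a) 1). norm (x /\<^sub>R norm x) = 1"
    by (subst AE_uniform_measure) (use ball_probability[where 'a='a] in \<open>auto simp: top.not_eq_extremum\<close>)
  then show ?thesis unfolding sphere_uniform_def by (subst AE_distr_iff) auto
qed

lemma measurable_polar [measurable]:
  "(\<lambda>(r, s). r *\<^sub>R s) \<in> borel_measurable (uniform_measure lborel {0..1::real} \<Otimes>\<^sub>M (sphere_uniform :: 'a::euclidean_space measure))"
  unfolding split_beta by measurable

lemma prob_space_spherical_uniform: "prob_space (spherical_uniform :: 'a::euclidean_space measure)"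
proof -
  interpret A: prob_space "uniform_measure lborel {0..1::real}" by (rule prob_space_unit_interval)
  interpret B: prob_space "sphere_uniform :: 'a measure" by (rule prob_space_sphere_uniform)
  interpret pair_prob_space "uniform_measure lborel {0..1::real}" "sphere_uniform :: 'a measure" ..
  show ?thesis unfolding spherical_uniform_def by (rule prob_space_distr) measurable
qed

lemma emeasure_spherical_uniform:
  fixes A :: "'a::euclidean_space set"
  assumes [measurable]: "A \<in> sets borel"
  shows "emeasure spherical_uniform A = (\<integral>\<^sup>+ r. emeasure sphere_uniform {s. r *\<^sub>R s \<in> A} \<partial>uniform_measure lborel {0..1::real})"
proof -
  interpret B: prob_space "sphere_uniform :: 'a measure" by (rule prob_space_sphere_uniform)
  have [simp]: "space (sphere_uniform :: 'a measure) = UNIV" by (simp add: sphere_uniform_def)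
  have m: "(\<lambda>(r, s). r *\<^sub>R s) -` A \<inter> space (uniform_measure lborel {0..1::real} \<Otimes>\<^sub>M (sphere_uniform :: 'a measure))
     \<in> sets (uniform_measure lborel {0..1::real} \<Otimes>\<^sub>M (sphere_uniform :: 'a measure))"
    by (rule measurable_sets[OF measurable_polar assms])
  have "emeasure spherical_uniform A = emeasure (uniform_measure lborel {0..1::real} \<Otimes>\<^sub>M sphere_uniform)
     ((\<lambda>(r, s). r *\<^sub>R s) -` A \<inter> space (uniform_measure lborel {0..1::real} \<Otimes>\<^sub>M (sphere_uniform :: 'a measure)))"
    unfolding spherical_uniform_def by (rule emeasure_distr[OF measurable_polar assms])
  also have "\<dots> = (\<integral>\<^sup>+ r. emeasure sphere_uniform {s. r *\<^sub>R s \<in> A} \<partial>uniform_measure lborel {0..1::real})"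
    by (subst B.emeasure_pair_measure_alt[OF m]) (simp add: space_pair_measure vimage_def)
  finally show ?thesis .
qed

text \<open>On the unit sphere \<open>norm (r *\<^sub>R s)\<close> is the absolute value of
  \<open>r\<close>, so the inner measure in polar coordinates is 0 or 1 and only the law of the
  radius remains.\<close>

lemma emeasure_spherical_uniform_radial:
  fixes A :: "'a::euclidean_space set"
  assumes A: "A \<in> sets borel" and P [measurable]: "Measurable.pred borel P" and AP: "\<And>u. u \<in> A \<longleftrightarrow> P (norm u)"
  shows "emeasure spherical_uniform A = emeasure (uniform_measure lborel {0..1::real}) {r. P \<bar>r\<bar>}"
proof -
  interpret B: prob_space "sphere_uniform :: 'a measure" by (rule prob_space_sphere_uniform)
  have [simp]: "space (sphere_uniform :: 'a measure) = UNIV" by (simp add: sphere_uniform_def)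
  have "emeasure sphere_uniform {s. r *\<^sub>R s \<in> A} = indicator {r. P \<bar>r\<bar>} r" for r
  proof -
    have "emeasure sphere_uniform {s. r *\<^sub>R s \<in> A} = emeasure sphere_uniform {s::'a. P \<bar>r\<bar>}"
    proof (rule emeasure_eq_AE)
      show "AE s in sphere_uniform. s \<in> {s::'a. r *\<^sub>R s \<in> A} \<longleftrightarrow> s \<in> {s::'a. P \<bar>r\<bar>}"
        using AE_sphere_uniform by eventually_elim (simp add: AP)
    qed (use A in measurable)
    also have "\<dots> = indicator {r. P \<bar>r\<bar>} r" using B.emeasure_space_1 by (auto simp: indicator_def)
    finally show ?thesis .
  qed
  then show ?thesis by (simp add: emeasure_spherical_uniform[OF A])
qed

lemma measure_spherical_uniform_cball:
  assumes "0 \<le> \<tau>" "\<tau> \<le> 1"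
  shows "measure (spherical_uniform :: 'a::euclidean_space measure) (cball 0 \<tau>) = \<tau>"
proof -
  have "{0..1} \<inter> {r. \<bar>r\<bar> \<le> \<tau>} = {0..\<tau>}" using assms by auto
  then have "emeasure (spherical_uniform :: 'a measure) (cball 0 \<tau>) = ennreal \<tau>"
    using assms by (subst emeasure_spherical_uniform_radial[where P="\<lambda>r. r \<le> \<tau>"])
      (auto simp: divide_ennreal_def)
  then show ?thesis using assms by (simp add: measure_def)
qed

lemma AE_spherical_uniform_ball: "AE u in (spherical_uniform :: 'a::euclidean_space measure). u \<in> ball 0 1"
proof -
  interpret prob_space "spherical_uniform :: 'a measure" by (rule prob_space_spherical_uniform)
  have "{0..1} \<inter> {r. \<bar>r\<bar> < 1} = {0..<1::real}" by auto
  then have "emeasure (spherical_uniform :: 'a measure) (ball 0 1) = 1"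
    by (subst emeasure_spherical_uniform_radial[where P="\<lambda>r. r < 1"]) (auto simp: divide_ennreal_def)
  then show ?thesis by (intro AE_prob_1) (simp add: measure_def)
qed

text \<open>Around the polar coordinates of a nonzero point of \<open>U\<close> there is a box
  \<open>A \<times> B\<close> of radii and directions mapped into \<open>U\<close>, and both factors
  have positive mass.\<close>

lemma emeasure_spherical_uniform_open_pos:
  fixes U :: "'a::euclidean_space set"
  assumes U: "open U" "U \<noteq> {}" "U \<subseteq> ball 0 1"
  shows "emeasure spherical_uniform U > 0"
proof -
  obtain p where p: "p \<in> U" "p \<noteq> 0"
  proof -
    have "U \<noteq> {0}" using U(1) not_open_singleton by auto
    then show ?thesis using U(2) that by blast
  qed
  define q where "q = p /\<^sub>R norm p"
  have p1: "norm p < 1" using p U by auto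
  have "open ((\<lambda>x::real \<times> 'a. fst x *\<^sub>R snd x) -` U)"
    by (intro open_vimage U(1) continuous_intros)
  moreover have "(norm p, q) \<in> (\<lambda>x::real \<times> 'a. fst x *\<^sub>R snd x) -` U"
    using p by (simp add: q_def)
  ultimately obtain A B where AB: "open A" "norm p \<in> A" "open B" "q \<in> B" "A \<times> B \<subseteq> (\<lambda>x. fst x *\<^sub>R snd x) -` U"
    by (rule open_prod_elim) auto
  have AB': "r *\<^sub>R s \<in> U" if "r \<in> A" "s \<in> B" for r s using AB(5) that by auto
  have slice: "{s. r *\<^sub>R s \<in> U} \<in> sets borel" for r
  proof -
    have "open ((\<lambda>s. r *\<^sub>R s) -` U)" by (intro open_vimage U(1) continuous_intros)
    then show ?thesis by (simp add: vimage_def)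
  qed
  have "emeasure sphere_uniform B > 0"
  proof -
    \<comment> \<open>The part of the cone over \<open>B\<close> inside the punctured ball, which is
      open because normalisation is continuous away from 0.\<close>
    let ?V = "{x \<in> ball 0 1 - {0}. x /\<^sub>R norm x \<in> B}"
    have "open ?V"
    proof -
      have "continuous_on (ball 0 1 - {0::'a}) (\<lambda>x. x /\<^sub>R norm x)" by (auto intro!: continuous_intros)
      from continuous_open_preimage[OF this _ AB(3)] show ?thesis
        by (simp add: open_delete vimage_def Int_def conj_commute)
    qed
    moreover have "p \<in> ?V" using p p1 AB(4) by (simp add: q_def)
    ultimately have "emeasure lborel ?V > 0" by (intro emeasure_lborel_pos_open) auto
    also have "emeasure lborel ?V \<le> emeasure lborel (ball 0 1 \<inter> (\<lambda>x. x /\<^sub>R norm x) -` B)"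
    proof (rule emeasure_mono)
      have "(\<lambda>x::'a. x /\<^sub>R norm x) -` B \<in> sets borel"
        using measurable_sets[of "\<lambda>x::'a. x /\<^sub>R norm x" borel borel B] AB(3) by simp
      then show "ball 0 1 \<inter> (\<lambda>x::'a. x /\<^sub>R norm x) -` B \<in> sets lborel" by simp
    qed auto
    finally have "emeasure lborel (ball 0 1 \<inter> (\<lambda>x. x /\<^sub>R norm x) -` B) > 0" .
    moreover have "(\<lambda>x::'a. x /\<^sub>R norm x) -` B \<in> sets borel"
      using measurable_sets[of "\<lambda>x::'a. x /\<^sub>R norm x" borel borel B] AB(3) by simp
    ultimately show ?thesis unfolding sphere_uniform_def
      using ball_probability[where 'a='a] AB(3)
      by (subst emeasure_distr) (auto simp: divide_eq_0_iff zero_less_iff_neq_zero ennreal_divide_eq_0_iff)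
  qed
  moreover have "emeasure (uniform_measure lborel {0..1::real}) A > 0"
  proof -
    have "emeasure lborel (A \<inter> {0<..<1}) > 0" 
      using AB p p1 by (intro emeasure_lborel_pos_open) auto
    also have "\<dots> \<le> emeasure lborel ({0..1} \<inter> A)" using AB(1) by (intro emeasure_mono) auto
    finally show ?thesis using AB(1) by (simp add: divide_ennreal_def)
  qed
  moreover have "emeasure sphere_uniform B * emeasure (uniform_measure lborel {0..1::real}) A \<le> emeasure spherical_uniform U"
  proof -
    have "emeasure sphere_uniform B * emeasure (uniform_measure lborel {0..1::real}) A
      = (\<integral>\<^sup>+ r. emeasure sphere_uniform B * indicator A r \<partial>uniform_measure lborel {0..1::real})"
      using AB(1) by (subst nn_integral_cmult_indicator) auto
    also have "\<dots> \<le> emeasure spherical_uniform U"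
      using U(1) AB' by (subst emeasure_spherical_uniform, simp, intro nn_integral_mono)
        (auto simp: indicator_def intro!: emeasure_mono slice)
    finally show ?thesis .
  qed
  ultimately show ?thesis
    by (metis ennreal_zero_less_mult_iff order_less_le_trans)
qed

section \<open>Uniqueness of the subdifferential\<close>

text \<open>Aleksandrov's lemma: if the subdifferentials of \<open>\<phi>\<close> and \<open>\<psi>\<close>, normalised to agree at \<open>p\<close>, were
  disjoint at \<open>p\<close>, then the subgradients of \<open>\<phi>\<close> over \<open>M = {\<phi> > \<psi>}\<close> would be subgradients of \<open>\<psi>\<close> only
  inside \<open>M\<close> and away from \<open>p\<close>, so \<open>\<psi>\<close> would give them less mass than \<open>\<phi>\<close> does.\<close>
lemma subdifferentials_meet:
  fixes \<phi> \<psi> :: "'a::euclidean_space \<Rightarrow> real"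
  assumes \<phi>: "convex_on (ball 0 1) \<phi>" and \<psi>: "convex_on (ball 0 1) \<psi>"
    and dom: "\<And>C. compact C \<Longrightarrow> C \<subseteq> ball 0 1 \<Longrightarrow> emeasure spherical_uniform C \<le>
      emeasure spherical_uniform {u \<in> ball 0 1. subdifferential \<psi> u \<inter> (\<Union>v\<in>C. subdifferential \<phi> v) \<noteq> {}}"
    and p: "p \<in> ball 0 1"
  shows "subdifferential \<phi> p \<inter> subdifferential \<psi> p \<noteq> {}"
proof
  assume disj: "subdifferential \<phi> p \<inter> subdifferential \<psi> p = {}"
  define c where "c = \<phi> p - \<psi> p"
  define M where "M = {v \<in> ball 0 1. \<phi> v > \<psi> v + c}"
  interpret prob_space "spherical_uniform :: 'a measure" by (rule prob_space_spherical_uniform)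
  have "open M"
  proof -
    have "continuous_on (ball 0 1) (\<lambda>v. \<phi> v - (\<psi> v + c))"
      by (intro continuous_intros convex_on_continuous \<phi> \<psi>) auto
    from continuous_open_preimage[OF this _ open_greaterThan[of 0]]
    have "open (ball 0 1 \<inter> (\<lambda>v. \<phi> v - (\<psi> v + c)) -` {0<..})" by simp
    also have "ball 0 1 \<inter> (\<lambda>v. \<phi> v - (\<psi> v + c)) -` {0<..} = M" by (auto simp: M_def)
    finally show ?thesis .
  qed
  \<comment> \<open>A slope \<open>x\<close> shared by \<open>\<phi>\<close> at a point of
    \<open>M\<close> and by \<open>\<psi>\<close> at \<open>u\<close> puts the shifted supporting
    function of \<open>\<psi>\<close> at \<open>u\<close> strictly below \<open>\<phi>\<close>.
    Taking \<open>z = u\<close> gives \<open>u \<in> M\<close>; letting \<open>u\<close> tend to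
    \<open>p\<close> gives a subgradient of \<open>\<phi>\<close> at \<open>p\<close>.\<close>
  have swap: "\<psi> u + c + inner x (z - u) < \<phi> z"
    if "m \<in> M" "x \<in> subdifferential \<phi> m" "x \<in> subdifferential \<psi> u" "u \<in> ball 0 1" "z \<in> ball 0 1" for m x u z
    using subdifferentialD[OF that(2,5)] subdifferentialD[OF that(3), of m] that(1)
    by (simp add: M_def inner_diff_right)
  \<comment> \<open>Otherwise slopes over \<open>M\<close> are shared by \<open>\<psi>\<close> at
    points tending to \<open>p\<close>. A limit of these slopes is a subgradient of
    \<open>\<psi>\<close> at \<open>p\<close> by compactness and one of \<open>\<phi>\<close> at
    \<open>p\<close> by \<open>swap\<close>, against \<open>disj\<close>.\<close>
  obtain e where e: "e > 0" "\<And>u m. u \<in> ball 0 1 \<Longrightarrow> u \<in> ball p e \<Longrightarrow> m \<in> M \<Longrightarrow>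
      subdifferential \<psi> u \<inter> subdifferential \<phi> m = {}"
  proof (rule ccontr)
    assume no: "\<not> thesis"
    define d where "d = (1 - norm p) / 2"
    have d: "d > 0" "norm p + d < 1" using p by (auto simp: d_def field_simps)
    have "\<forall>n. \<exists>u m x. u \<in> ball 0 1 \<and> u \<in> ball p (d / real (Suc n)) \<and> m \<in> M \<and> x \<in> subdifferential \<psi> u \<inter> subdifferential \<phi> m"
    proof
      fix n show "\<exists>u m x. u \<in> ball 0 1 \<and> u \<in> ball p (d / real (Suc n)) \<and> m \<in> M \<and> x \<in> subdifferential \<psi> u \<inter> subdifferential \<phi> m"
      proof (rule ccontr)
        assume *: "\<not> ?thesis"
        have "0 < d / real (Suc n)" using d by simp
        then show False by (rule notE[OF no that]) (use * in blast)
      qed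
    qed
    then obtain u m x where umx: "\<And>n. u n \<in> ball 0 1" "\<And>n. u n \<in> ball p (d / real (Suc n))" "\<And>n. m n \<in> M"
      "\<And>n. x n \<in> subdifferential \<psi> (u n)" "\<And>n. x n \<in> subdifferential \<phi> (m n)" by (metis IntD1 IntD2)
    have ucb: "u n \<in> cball 0 (norm p + d)" for n
    proof -
      have "dist p (u n) < d / real (Suc n)" using umx(2)[of n] by simp
      also have "\<dots> \<le> d / 1" using d by (intro divide_left_mono) auto
      finally have "norm (u n - p) < d" by (simp add: dist_norm norm_minus_commute)
      moreover have "norm (u n) \<le> norm p + norm (u n - p)" by (rule norm_triangle_sub)
      ultimately show ?thesis by simp
    qed
    obtain l y k where k: "l \<in> cball 0 (norm p + d)" "y \<in> subdifferential \<psi> l" "strict_mono (k::nat \<Rightarrow> nat)"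
      "(u \<circ> k) \<longlonglongrightarrow> l" "(x \<circ> k) \<longlonglongrightarrow> y"
      using subdifferential_seq_compact[OF \<psi> d(2), of u x] ucb umx(4) by blast
    have "u \<longlonglongrightarrow> p"
    proof (rule metric_tendsto_imp_tendsto[of "\<lambda>n. d / real (Suc n)" 0])
      show "(\<lambda>n. d / real (Suc n)) \<longlonglongrightarrow> 0"
        by (rule LIMSEQ_Suc[OF lim_const_over_n])
      show "\<forall>\<^sub>F n in sequentially. dist (u n) p \<le> dist (d / real (Suc n)) 0"
        using umx(2) d by (intro always_eventually allI) (simp add: dist_commute less_imp_le)
    qed
    then have "l = p" using k(3,4) LIMSEQ_subseq_LIMSEQ LIMSEQ_unique by blast
    have "y \<in> subdifferential \<phi> p"
    proof (rule subdifferentialI)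
      fix z :: 'a assume z: "z \<in> ball 0 1"
      have "isCont \<psi> p" using convex_on_continuous[OF open_ball \<psi>] p
        by (simp add: continuous_on_eq_continuous_at)
      from isCont_tendsto_compose[OF this k(4)[unfolded \<open>l = p\<close>]]
      have "(\<lambda>n. \<psi> ((u \<circ> k) n)) \<longlonglongrightarrow> \<psi> p" .
      then have "(\<lambda>n. \<psi> ((u \<circ> k) n) + c + inner ((x \<circ> k) n) (z - (u \<circ> k) n)) \<longlonglongrightarrow> \<psi> p + c + inner y (z - p)"
        using k(4,5) unfolding o_def \<open>l = p\<close> by (intro tendsto_intros)
      then have "\<psi> p + c + inner y (z - p) \<le> \<phi> z"
        using swap[OF umx(3,5,4,1) z] by (intro LIMSEQ_le_const2) (auto intro: less_imp_le)
      then show "\<phi> p + inner y (z - p) \<le> \<phi> z" by (simp add: c_def)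
    qed
    then show False using disj k(2) \<open>l = p\<close> by auto
  qed
  \<comment> \<open>If \<open>\<phi> \<le> \<psi> + c\<close> near \<open>p\<close>, with equality
    at \<open>p\<close>, every subgradient of \<open>\<phi>\<close> at \<open>p\<close> is locally,
    hence globally, one of \<open>\<psi>\<close>.\<close>
  have "M \<inter> ball p e \<noteq> {}"
  proof
    assume emp: "M \<inter> ball p e = {}"
    obtain x where x: "x \<in> subdifferential \<phi> p" using subdifferential_nonempty[OF \<phi> p] by auto
    have "x \<in> subdifferential \<psi> p"
    proof (rule local_subgradient[OF \<psi> p e(1)])
      fix v assume "v \<in> ball (0::'a) 1" "v \<in> ball p e"
      then show "\<psi> p + inner x (v - p) \<le> \<psi> v"
        using emp subdifferentialD[OF x, of v] by (fastforce simp: M_def c_def)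
    qed
    then show False using x disj by auto
  qed
  then have pos: "emeasure spherical_uniform (M \<inter> ball p e) > 0"
    using \<open>open M\<close> by (intro emeasure_spherical_uniform_open_pos) (auto simp: M_def)
  have "emeasure spherical_uniform C \<le> emeasure spherical_uniform (M - ball p e)" if C: "compact C" "C \<subseteq> M" for C
  proof -
    have "C \<subseteq> ball 0 1" using C(2) by (auto simp: M_def)
    then have "emeasure spherical_uniform C \<le>
      emeasure spherical_uniform {u \<in> ball 0 1. subdifferential \<psi> u \<inter> (\<Union>v\<in>C. subdifferential \<phi> v) \<noteq> {}}"
      by (rule dom[OF C(1)])
    also have "\<dots> \<le> emeasure spherical_uniform (M - ball p e)"
    proof (rule emeasure_mono)
      show "{u \<in> ball 0 1. subdifferential \<psi> u \<inter> (\<Union>v\<in>C. subdifferential \<phi> v) \<noteq> {}} \<subseteq> M - ball p e"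
      proof
        fix u assume "u \<in> {u \<in> ball 0 1. subdifferential \<psi> u \<inter> (\<Union>v\<in>C. subdifferential \<phi> v) \<noteq> {}}"
        then obtain x v where xv: "u \<in> ball 0 1" "x \<in> subdifferential \<psi> u" "x \<in> subdifferential \<phi> v" "v \<in> M"
          using C by blast
        moreover have "u \<in> M" using swap[OF xv(4,3,2,1,1)] xv(1) by (simp add: M_def)
        moreover have "u \<notin> ball p e" using e(2)[OF xv(1) _ xv(4)] xv(2,3) by blast
        ultimately show "u \<in> M - ball p e" by blast
      qed
    qed (use \<open>open M\<close> in auto)
    finally show ?thesis .
  qed
  \<comment> \<open>The comparison \<open>dom\<close> concerns compact sets; inner regularity
    carries it to the open set \<open>M\<close>.\<close>
  then have "emeasure spherical_uniform M \<le> emeasure spherical_uniform (M - ball p e)"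
    using \<open>open M\<close> by (subst inner_regular) (auto intro!: SUP_least simp: emeasure_eq_measure)
  moreover have "emeasure spherical_uniform M =
      emeasure spherical_uniform (M - ball p e) + emeasure spherical_uniform (M \<inter> ball p e)"
    using \<open>open M\<close> by (subst plus_emeasure) (auto intro!: arg_cong2[where f=emeasure])
  ultimately show False using pos by (simp add: emeasure_eq_measure ennreal_plus[symmetric] del: ennreal_plus)
qed

section \<open>Stability of subgradient transports\<close>

text \<open>The differentiability in \<open>quantile_potential\<close> is relaxed to an almost
  everywhere selection of subgradients, the form in which monotonicity and compactness can be
  applied.\<close>

definition subgradient_transport :: "('a::euclidean_space \<Rightarrow> real) \<Rightarrow> ('a \<Rightarrow> 'a) \<Rightarrow> 'a measure \<Rightarrow> bool" where
  "subgradient_transport \<phi> G \<nu> \<longleftrightarrow>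
     convex_on (ball 0 1) \<phi> \<and> G \<in> borel_measurable borel \<and>
     (AE u in spherical_uniform. u \<in> ball 0 1 \<and> G u \<in> subdifferential \<phi> u) \<and>
     distr spherical_uniform borel G = \<nu>"

lemma quantile_potential_imp_transport:
  fixes \<nu> :: "'a::euclidean_space measure"
  assumes "quantile_potential \<nu> \<phi>"
  obtains G where "subgradient_transport \<phi> G \<nu>"
proof -
  from assms obtain G where G: "convex_on (ball 0 1) \<phi>" "G \<in> borel_measurable borel"
    "AE u in spherical_uniform. GDERIV \<phi> u :> G u" "distr spherical_uniform borel G = \<nu>"
    by (auto simp: quantile_potential_def)
  have "AE u in spherical_uniform. u \<in> ball 0 1 \<and> G u \<in> subdifferential \<phi> u"
    using G(3) AE_spherical_uniform_ball
    by eventually_elim (use gradient_in_subdifferential[OF G(1)] in blast)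
  then show ?thesis using G that[of G] by (simp add: subgradient_transport_def)
qed

lemma subgradient_transport_add_const:
  assumes "subgradient_transport \<phi> G \<nu>"
  shows "subgradient_transport (\<lambda>v. \<phi> v + c) G \<nu>"
proof -
  have "subdifferential (\<lambda>v. \<phi> v + c) u = subdifferential \<phi> u" for u
    by (auto simp: subdifferential_def)
  moreover have "convex_on (ball 0 1) (\<lambda>v. \<phi> v + c)"
    using assms by (intro convex_on_add) (auto simp: subgradient_transport_def convex_on_const)
  ultimately show ?thesis using assms by (simp add: subgradient_transport_def)
qed

text \<open>Finite unions of sets from a countable base: finitely many basic sets inside
  \<open>W\<close> cover the compact set \<open>F\<close>.\<close>

lemma countable_separating_opens:
  obtains \<U> :: "'a::second_countable_topology set set"
  where "countable \<U>" "\<And>U. U \<in> \<U> \<Longrightarrow> open U"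
    "\<And>F W. compact F \<Longrightarrow> open W \<Longrightarrow> F \<subseteq> W \<Longrightarrow> \<exists>U\<in>\<U>. F \<subseteq> U \<and> U \<subseteq> W"
proof -
  obtain B :: "'a set set" where B: "countable B" "topological_basis B"
    using ex_countable_basis by blast
  show ?thesis
  proof (rule that[of "Union ` {A. finite A \<and> A \<subseteq> B}"])
    show "countable (Union ` {A. finite A \<and> A \<subseteq> B})"
      using countable_Collect_finite_subset[OF B(1)] by (rule countable_image)
    show "open U" if "U \<in> Union ` {A. finite A \<and> A \<subseteq> B}" for U
      using that topological_basis_open[OF B(2)] by auto
    show "\<exists>U\<in>Union ` {A. finite A \<and> A \<subseteq> B}. F \<subseteq> U \<and> U \<subseteq> W" if F: "compact F" "open W" "F \<subseteq> W" for F W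
    proof -
      obtain B' where B': "B' \<subseteq> B" "\<Union>B' = W" using B(2) F(2) by (auto simp: topological_basis_def)
      then obtain A where "A \<subseteq> B'" "finite A" "F \<subseteq> \<Union>A"
        using compactE[OF F(1), of B'] F(3) topological_basis_open[OF B(2)] by (metis subsetD)
      then show ?thesis using B' by blast
    qed
  qed
qed

text \<open>The primed objects belong to the limit. They are linked to the sequence only by masses
  of sets in \<open>\<U>\<close>; no convergence of potentials or transports is presupposed.\<close>

locale converging_transports =
  fixes \<phi> :: "nat \<Rightarrow> 'a::euclidean_space \<Rightarrow> real" and G :: "nat \<Rightarrow> 'a \<Rightarrow> 'a" and \<nu> :: "nat \<Rightarrow> 'a measure"
    and \<phi>' :: "'a \<Rightarrow> real" and G' :: "'a \<Rightarrow> 'a" and \<nu>' :: "'a measure" and \<U> :: "'a set set"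
  assumes sep: "\<And>F W. compact F \<Longrightarrow> open W \<Longrightarrow> F \<subseteq> W \<Longrightarrow> \<exists>U\<in>\<U>. F \<subseteq> U \<and> U \<subseteq> W"
    and opn: "\<And>U. U \<in> \<U> \<Longrightarrow> open U"
    and tr: "\<And>n. subgradient_transport (\<phi> n) (G n) (\<nu> n)"
    and tr': "subgradient_transport \<phi>' G' \<nu>'"
    and conv: "\<And>U. U \<in> \<U> \<Longrightarrow> (\<lambda>n. measure (\<nu> n) U) \<longlonglongrightarrow> measure \<nu>' U"
begin

sublocale prob_space "spherical_uniform :: 'a measure" by (rule prob_space_spherical_uniform)

lemma cvx: "convex_on (ball 0 1) (\<phi> n)" and G_meas [measurable]: "G n \<in> borel_measurable borel"
  and G_AE: "AE u in spherical_uniform. u \<in> ball 0 1 \<and> G n u \<in> subdifferential (\<phi> n) u"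
  and distr_G: "\<nu> n = distr spherical_uniform borel (G n)"
  using tr[of n] by (auto simp: subgradient_transport_def)

lemma cvx': "convex_on (ball 0 1) \<phi>'" and G'_meas [measurable]: "G' \<in> borel_measurable borel"
  and G'_AE: "AE u in spherical_uniform. u \<in> ball 0 1 \<and> G' u \<in> subdifferential \<phi>' u"
  and distr_G': "\<nu>' = distr spherical_uniform borel G'"
  using tr' by (auto simp: subgradient_transport_def)

section \<open>Tightness and compactness of the potentials\<close>

lemma prob_\<nu>: "prob_space (\<nu> n)" "prob_space \<nu>'"
  unfolding distr_G distr_G' by (auto intro!: prob_space_distr)

lemma sets_\<nu> [simp]: "sets (\<nu> n) = sets borel" "space (\<nu> n) = UNIV" "sets \<nu>' = sets borel" "space \<nu>' = UNIV"
  unfolding distr_G distr_G' by auto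

lemma measure_\<nu>: "A \<in> sets borel \<Longrightarrow> measure (\<nu> n) A = prob {u. G n u \<in> A}"
  unfolding distr_G by (subst measure_distr) (auto simp: vimage_def)

text \<open>A set of \<open>\<U>\<close> squeezed between two concentric balls carries the mass of a
  large ball from the limit back to the sequence.\<close>

lemma tight:
  assumes e: "e > 0"
  obtains L where "\<forall>\<^sub>F n in sequentially. measure (\<nu> n) {x. norm x > L} < e"
proof -
  interpret N: prob_space \<nu>' by (rule prob_\<nu>)
  have "(\<Union>n. cball (0::'a) (real n)) = UNIV" using real_arch_simple by auto
  moreover have "(\<lambda>n. measure \<nu>' (cball 0 (real n))) \<longlonglongrightarrow> measure \<nu>' (\<Union>n. cball 0 (real n))"
    by (rule N.finite_Lim_measure_incseq) (auto simp: incseq_def)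
  ultimately have "(\<lambda>n. measure \<nu>' (cball 0 (real n))) \<longlonglongrightarrow> 1" using N.prob_space by simp
  then have "\<forall>\<^sub>F n in sequentially. measure \<nu>' (cball 0 (real n)) > 1 - e"
    using e by (intro order_tendstoD) auto
  then obtain m where m: "measure \<nu>' (cball 0 (real m)) > 1 - e" by (auto dest: eventually_happens)
  obtain U where U: "U \<in> \<U>" "cball 0 (real m) \<subseteq> U" "U \<subseteq> ball 0 (real m + 1)"
    using sep[of "cball 0 (real m)" "ball 0 (real m + 1)"] by (auto simp: subset_iff)
  have "1 - e < measure \<nu>' U"
    using m N.finite_measure_mono[OF U(2)] opn[OF U(1)] by simp
  then have "\<forall>\<^sub>F n in sequentially. 1 - e < measure (\<nu> n) U"
    by (rule order_tendstoD(1)[OF conv[OF U(1)]])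
  then have "\<forall>\<^sub>F n in sequentially. measure (\<nu> n) {x. norm x > real m + 1} < e"
  proof eventually_elim
    case (elim n)
    interpret Nn: prob_space "\<nu> n" by (rule prob_\<nu>)
    have "open {x::'a. norm x > real m + 1}" by (intro open_Collect_less continuous_intros)
    then have "measure (\<nu> n) {x. norm x > real m + 1} \<le> measure (\<nu> n) (UNIV - U)"
      using U opn[OF U(1)] by (intro Nn.finite_measure_mono) (auto dest: subsetD)
    also have "\<dots> = 1 - measure (\<nu> n) U" using Nn.prob_compl[of U] opn[OF U(1)] by simp
    finally show ?case using elim by simp
  qed
  then show ?thesis by (rule that)
qed

text \<open>A large subgradient at a point forces, by monotonicity, large subgradients on a whole ball of
  points ahead of it, which tightness forbids.\<close>
lemma subgradients_bounded:
  assumes r: "r < 1"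
  obtains L N where "\<And>n u x. n \<ge> N \<Longrightarrow> u \<in> cball 0 r \<Longrightarrow> x \<in> subdifferential (\<phi> n) u \<Longrightarrow> norm x \<le> L"
proof (rule ccontr)
  assume no: "\<not> thesis"
  have "\<forall>k. \<exists>n u x. n \<ge> k \<and> u \<in> cball 0 r \<and> x \<in> subdifferential (\<phi> n) u \<and> norm x > real k"
  proof (rule ccontr)
    assume "\<not> ?thesis"
    then obtain k where "\<And>n u x. n \<ge> k \<Longrightarrow> u \<in> cball 0 r \<Longrightarrow> x \<in> subdifferential (\<phi> n) u \<Longrightarrow> norm x \<le> real k"
      by (meson not_le)
    then show False using no that by blast
  qed
  then obtain n u x where nux: "\<And>k. n k \<ge> k" "\<And>k. u k \<in> cball 0 r"
    "\<And>k. x k \<in> subdifferential (\<phi> (n k)) (u k)" "\<And>k. norm (x k) > real k" by metis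
  define e where "e k = x k /\<^sub>R norm (x k)" for k
  have xpos: "norm (x k) > 0" for k using nux(4)[of k] by (rule le_less_trans[rotated]) simp
  have "seq_compact (cball (0::'a) r \<times> sphere (0::'a) 1)"
    by (rule compact_imp_seq_compact[OF compact_Times[OF compact_cball compact_sphere]])
  moreover have "\<forall>k. (u k, e k) \<in> cball 0 r \<times> sphere 0 1" using nux(2) xpos by (auto simp: e_def)
  ultimately obtain q s where q: "q \<in> cball 0 r \<times> sphere 0 1" "strict_mono (s::nat \<Rightarrow> nat)"
    "((\<lambda>k. (u k, e k)) \<circ> s) \<longlonglongrightarrow> q"
    by (rule seq_compactE)
  obtain l d where [simp]: "q = (l, d)" by (cases q)
  have lim: "(\<lambda>k. u (s k)) \<longlonglongrightarrow> l" "(\<lambda>k. e (s k)) \<longlonglongrightarrow> d"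
    using tendsto_fst[OF q(3)] tendsto_snd[OF q(3)] by (auto simp: o_def)
  have ld: "norm l \<le> r" "norm d = 1" using q(1) by auto
  \<comment> \<open>Half the distance left to the unit sphere, so that \<open>V\<close> below still
    fits inside the open unit ball.\<close>
  define h where "h = (1 - r) / 2"
  have h: "h > 0" "h < 1 - r" using r by (auto simp: h_def)
  define V where "V = ball (l + h *\<^sub>R d) (h / 4)"
  have Vsub: "V \<subseteq> ball 0 1"
  proof
    fix w assume "w \<in> V"
    then have "norm (w - (l + h *\<^sub>R d)) < h / 4" by (simp add: V_def dist_norm norm_minus_commute)
    moreover have "norm w \<le> norm (l + h *\<^sub>R d) + norm (w - (l + h *\<^sub>R d))" by (rule norm_triangle_sub)
    moreover have "norm (l + h *\<^sub>R d) \<le> norm l + norm (h *\<^sub>R d)" by (rule norm_triangle_ineq)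
    ultimately show "w \<in> ball 0 1" using ld h by (simp add: h_def field_simps)
  qed
  have "measure spherical_uniform V > 0"
    using emeasure_spherical_uniform_open_pos[of V] Vsub h by (simp add: V_def emeasure_eq_measure)
  then obtain L where L: "\<forall>\<^sub>F n in sequentially. measure (\<nu> n) {x. norm x > L} < measure spherical_uniform V"
    by (rule tight)
  have n_inf: "filterlim (\<lambda>k. n (s k)) sequentially sequentially"
  proof (rule filterlim_at_top_mono[OF filterlim_subseq[OF q(2)]])
    show "\<forall>\<^sub>F k in sequentially. s k \<le> n (s k)" using nux(1) by simp
  qed
  have s_inf: "filterlim (\<lambda>k. real (s k)) at_top sequentially"
    by (rule filterlim_compose[OF filterlim_real_sequentially filterlim_subseq[OF q(2)]])
  have "\<forall>\<^sub>F k in sequentially. measure (\<nu> (n (s k))) {x. norm x > L} < measure spherical_uniform V"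
    by (rule eventually_compose_filterlim[OF L n_inf])
  moreover have "\<forall>\<^sub>F k in sequentially. real (s k) > 8 * \<bar>L\<bar> / h"
    using s_inf by (simp add: filterlim_at_top_dense)
  moreover have "\<forall>\<^sub>F k in sequentially. dist (u (s k)) l < h / 4"
    using lim(1) h by (intro tendstoD) auto
  moreover have "\<forall>\<^sub>F k in sequentially. dist (e (s k)) d < h / 8"
    using lim(2) h by (intro tendstoD) auto
  ultimately have "\<forall>\<^sub>F k in sequentially. False"
  proof eventually_elim
    case (elim k)
    let ?k = "s k" let ?n = "n (s k)"
    \<comment> \<open>Seen from \<open>l\<close>, each \<open>w\<close> in \<open>V\<close> is at
      least \<open>3 * h / 4\<close> ahead in direction \<open>d\<close>. Replacing \<open>l\<close>
      by \<open>u ?k\<close> and \<open>d\<close> by \<open>e ?k\<close> costs at most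
      \<open>h / 4\<close> each, which leaves \<open>h / 4\<close>. Monotonicity and
      \<open>norm (w - u ?k) \<le> 2\<close> then give
      \<open>norm y \<ge> norm (x ?k) * (h / 8)\<close>, whence the threshold
      \<open>8 * \<bar>L\<bar> / h\<close>.\<close>
    have big: "L < norm y" if w: "w \<in> V" and y: "y \<in> subdifferential (\<phi> ?n) w" for w y
    proof -
      have wb: "w \<in> ball 0 1" "u ?k \<in> ball 0 1" using w Vsub nux(2)[of ?k] r by auto
      have "norm (w - u ?k) \<le> 2" using norm_triangle_ineq4[of w "u ?k"] wb by simp
      have "inner d (w - l) = h + inner d (w - (l + h *\<^sub>R d))"
        using ld(2) by (simp add: inner_diff_right inner_add_right power2_norm_eq_inner[symmetric])
      moreover have "\<bar>inner d (w - (l + h *\<^sub>R d))\<bar> \<le> 1 * (h / 4)"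
        using Cauchy_Schwarz_ineq2[of d "w - (l + h *\<^sub>R d)"] w ld(2)
        by (simp add: V_def dist_norm norm_minus_commute)
      moreover have "\<bar>inner d (l - u ?k)\<bar> \<le> 1 * (h / 4)"
        using Cauchy_Schwarz_ineq2[of d "l - u ?k"] elim(3) ld(2)
        by (simp add: dist_norm norm_minus_commute)
      moreover have "\<bar>inner (e ?k - d) (w - u ?k)\<bar> \<le> h / 8 * 2"
        using Cauchy_Schwarz_ineq2[of "e ?k - d" "w - u ?k"] elim(4) h(1) \<open>norm (w - u ?k) \<le> 2\<close>
          mult_mono[of "norm (e ?k - d)" "h / 8" "norm (w - u ?k)" 2]
        by (simp add: dist_norm)
      moreover have "inner (e ?k) (w - u ?k) = inner d (w - l) + inner d (l - u ?k) + inner (e ?k - d) (w - u ?k)"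
        by (simp add: inner_diff_left inner_diff_right)
      ultimately have "inner (e ?k) (w - u ?k) \<ge> h / 4" by argo
      then have "norm (x ?k) * (h / 4) \<le> norm (x ?k) * inner (e ?k) (w - u ?k)"
        by (intro mult_left_mono) auto
      also have "\<dots> = inner (x ?k) (w - u ?k)" using xpos[of ?k] by (simp add: e_def)
      also have "\<dots> \<le> inner y (w - u ?k)"
        using subdifferential_monotone[OF y nux(3) wb] by (simp add: inner_diff_left)
      also have "\<dots> \<le> norm y * 2"
        using norm_cauchy_schwarz[of y "w - u ?k"] mult_left_mono[OF \<open>norm (w - u ?k) \<le> 2\<close>, of "norm y"] by simp
      finally have "norm (x ?k) * (h / 8) \<le> norm y" by simp
      moreover have "8 * \<bar>L\<bar> / h < norm (x ?k)" using elim(2) nux(4)[of ?k] by simp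
      then have "\<bar>L\<bar> < norm (x ?k) * (h / 8)" using h by (simp add: field_simps)
      ultimately show ?thesis by linarith
    qed
    have "prob V \<le> prob {w. G ?n w \<in> {x. norm x > L}}"
    proof (rule finite_measure_mono_AE)
      show "AE w in spherical_uniform. w \<in> V \<longrightarrow> w \<in> {w. G ?n w \<in> {x. norm x > L}}"
        using G_AE[of ?n] by eventually_elim (use big in auto)
    qed measurable
    also have "\<dots> = measure (\<nu> ?n) {x. norm x > L}" by (rule measure_\<nu>[symmetric]) measurable
    finally show False using elim(1) by simp
  qed
  then show False by simp
qed

text \<open>A subgradient at \<open>u\<close> bounds the increment from \<open>v\<close> to
  \<open>u\<close> by its norm times the distance, and those norms are bounded uniformly in
  \<open>n \<ge> N\<close>.\<close>

lemma equi_Lipschitz: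
  assumes r: "r < 1"
  obtains L N where "L \<ge> 0"
    "\<And>n u v. n \<ge> N \<Longrightarrow> u \<in> cball 0 r \<Longrightarrow> v \<in> cball 0 r \<Longrightarrow> \<bar>\<phi> n u - \<phi> n v\<bar> \<le> L * norm (u - v)"
proof -
  obtain L N where L: "\<And>n u x. n \<ge> N \<Longrightarrow> u \<in> cball 0 r \<Longrightarrow> x \<in> subdifferential (\<phi> n) u \<Longrightarrow> norm x \<le> L"
    by (rule subgradients_bounded[OF r]) blast
  have *: "\<phi> n u - \<phi> n v \<le> \<bar>L\<bar> * norm (u - v)" if n: "n \<ge> N" and u: "u \<in> cball 0 r" and v: "v \<in> cball 0 r" for n and u v :: 'a
  proof -
    have b: "u \<in> ball 0 1" "v \<in> ball 0 1" using u v r by auto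
    obtain x where x: "x \<in> subdifferential (\<phi> n) u" using subdifferential_nonempty[OF cvx b(1)] by blast
    have "\<phi> n u - \<phi> n v \<le> inner x (u - v)" using subdifferentialD[OF x b(2)] by (simp add: inner_diff_right)
    also have "\<dots> \<le> norm x * norm (u - v)" by (rule norm_cauchy_schwarz)
    also have "\<dots> \<le> \<bar>L\<bar> * norm (u - v)" using L[OF n u x] by (intro mult_right_mono) auto
    finally show ?thesis .
  qed
  show ?thesis
  proof (rule that[of "\<bar>L\<bar>" N])
    fix n and u v :: 'a assume a: "N \<le> n" "u \<in> cball 0 r" "v \<in> cball 0 r"
    show "\<bar>\<phi> n u - \<phi> n v\<bar> \<le> \<bar>L\<bar> * norm (u - v)"
      using *[OF a] *[OF a(1,3,2)] by (simp add: abs_le_iff norm_minus_commute)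
  qed simp
qed

text \<open>An Arzela-Ascoli argument: a diagonal subsequence converges on a countable dense set,
  and the common Lipschitz bound extends this to the ball. The normalisation at 0 stops additive
  constants from escaping to infinity.\<close>

lemma convergent_subsequence:
  assumes zero: "\<And>n. \<phi> n 0 = 0"
  obtains k \<psi> where "strict_mono (k::nat \<Rightarrow> nat)" "\<And>v. v \<in> ball 0 1 \<Longrightarrow> (\<lambda>n. \<phi> (k n) v) \<longlonglongrightarrow> \<psi> v"
proof -
  obtain D :: "'a set" where D: "countable D" "\<And>X. open X \<Longrightarrow> X \<noteq> {} \<Longrightarrow> \<exists>d\<in>D. d \<in> X"
    by (rule countable_dense_setE) blast
  have "\<exists>C>0. \<forall>n. \<bar>\<phi> n v\<bar> \<le> C" if v: "v \<in> ball 0 1" for v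
  proof -
    have "norm v < 1" using v by simp
    then obtain L N where L: "L \<ge> 0"
      "\<And>n u w. n \<ge> N \<Longrightarrow> u \<in> cball 0 (norm v) \<Longrightarrow> w \<in> cball 0 (norm v) \<Longrightarrow> \<bar>\<phi> n u - \<phi> n w\<bar> \<le> L * norm (u - w)"
      by (rule equi_Lipschitz) blast
    \<comment> \<open>The Lipschitz bound starts at index \<open>N\<close>; the sum absorbs the
      earlier indices, and the 1 makes the bound positive, since it becomes a divisor below.\<close>
    have "\<bar>\<phi> n v\<bar> \<le> 1 + L * norm v + (\<Sum>i<N. \<bar>\<phi> i v\<bar>)" for n
    proof (cases "n \<ge> N")
      case True
      then have "\<bar>\<phi> n v\<bar> \<le> L * norm v" using L(2)[of n v 0] zero by simp
      moreover have "0 \<le> (\<Sum>i<N. \<bar>\<phi> i v\<bar>)" by (intro sum_nonneg) auto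
      ultimately show ?thesis by linarith
    next
      case False
      then have "\<bar>\<phi> n v\<bar> \<le> (\<Sum>i<N. \<bar>\<phi> i v\<bar>)" by (intro member_le_sum) auto
      then show ?thesis using L(1) by (simp add: add_increasing)
    qed
    moreover have "1 + L * norm v + (\<Sum>i<N. \<bar>\<phi> i v\<bar>) > 0"
      using L(1) by (intro add_pos_nonneg sum_nonneg) auto
    ultimately show ?thesis by blast
  qed
  then obtain C where C: "\<And>v. v \<in> ball 0 1 \<Longrightarrow> C v > 0" "\<And>v n. v \<in> ball 0 1 \<Longrightarrow> \<bar>\<phi> n v\<bar> \<le> C v" by metis
  have "countable (D \<inter> ball 0 1)" using D(1) by auto
  \<comment> \<open>The diagonal argument takes one bound for all points, whereas \<open>C v\<close>
    depends on \<open>v\<close>; hence the rescaling.\<close>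
  moreover have "norm (\<phi> n v / C v) \<le> 1" if "v \<in> D \<inter> ball 0 1" for n v
    using C(1)[of v] C(2)[of v n] that by (simp add: divide_simps)
  ultimately obtain k where k: "strict_mono (k::nat \<Rightarrow> nat)"
    "\<And>v. v \<in> D \<inter> ball 0 1 \<Longrightarrow> \<exists>l. (\<lambda>n. \<phi> (k n) v / C v) \<longlonglongrightarrow> l"
    by (rule function_convergent_subsequence[of "D \<inter> ball 0 1" "\<lambda>n v. \<phi> n v / C v" 1]) (assumption, rule that)
  have dense: "Cauchy (\<lambda>n. \<phi> (k n) d)" if d: "d \<in> D" "d \<in> ball 0 1" for d
  proof -
    obtain l where "(\<lambda>n. \<phi> (k n) d / C d) \<longlonglongrightarrow> l" using k(2) d by auto
    then have "(\<lambda>n. C d * (\<phi> (k n) d / C d)) \<longlonglongrightarrow> C d * l" by (intro tendsto_intros)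
    then show ?thesis using C(1)[OF d(2)] by (intro LIMSEQ_imp_Cauchy) simp
  qed
  have "Cauchy (\<lambda>n. \<phi> (k n) v)" if v: "v \<in> ball 0 1" for v
  proof (rule CauchyI)
    fix e :: real assume e: "e > 0"
    define r where "r = (1 + norm v) / 2"
    have r: "r < 1" "norm v < r" using v by (auto simp: r_def)
    obtain L N where L: "L \<ge> 0"
      "\<And>n u w. n \<ge> N \<Longrightarrow> u \<in> cball 0 r \<Longrightarrow> w \<in> cball 0 r \<Longrightarrow> \<bar>\<phi> n u - \<phi> n w\<bar> \<le> L * norm (u - w)"
      by (rule equi_Lipschitz[OF r(1)]) blast
    \<comment> \<open>The radius makes replacing \<open>v\<close> by a dense point cost at most
      \<open>e / 4\<close> on either side, which leaves \<open>e / 2\<close> for the Cauchy property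
      at that point.\<close>
    have "v \<in> ball v (e / (4 * (L + 1))) \<inter> ball 0 r" using e L(1) r by simp
    then obtain d where d: "d \<in> D" "d \<in> ball v (e / (4 * (L + 1)))" "d \<in> ball 0 r"
      using D(2)[of "ball v (e / (4 * (L + 1))) \<inter> ball 0 r"] by blast
    have "L * norm (v - d) \<le> L * (e / (4 * (L + 1)))"
      using d(2) L(1) by (intro mult_left_mono) (auto simp: dist_norm)
    also have "\<dots> \<le> e / 4" using L(1) e by (simp add: field_simps)
    finally have close: "L * norm (v - d) \<le> e / 4" .
    have "d \<in> ball 0 1" using d(3) r by simp
    from CauchyD[OF dense[OF d(1) this], of "e / 2"] e obtain M where
      M: "\<And>m n. m \<ge> M \<Longrightarrow> n \<ge> M \<Longrightarrow> \<bar>\<phi> (k m) d - \<phi> (k n) d\<bar> < e / 2" by auto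
    show "\<exists>M. \<forall>m\<ge>M. \<forall>n\<ge>M. norm (\<phi> (k m) v - \<phi> (k n) v) < e"
    proof (intro exI[of _ "max M N"] allI impI)
      fix m n assume mn: "max M N \<le> m" "max M N \<le> n"
      have "\<bar>\<phi> (k i) v - \<phi> (k i) d\<bar> \<le> e / 4" if "max M N \<le> i" for i
      proof -
        have "N \<le> k i" using that seq_suble[OF k(1), of i] by simp
        then show ?thesis using L(2)[of "k i" v d] d(3) r close by simp
      qed
      from this[OF mn(1)] this[OF mn(2)]
      have "\<bar>\<phi> (k m) v - \<phi> (k m) d\<bar> \<le> e / 4" "\<bar>\<phi> (k n) v - \<phi> (k n) d\<bar> \<le> e / 4" .
      moreover have "\<bar>\<phi> (k m) d - \<phi> (k n) d\<bar> < e / 2" using M mn by simp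
      ultimately show "norm (\<phi> (k m) v - \<phi> (k n) v) < e" unfolding real_norm_def by linarith
    qed
  qed
  then have "\<And>v. v \<in> ball 0 1 \<Longrightarrow> (\<lambda>n. \<phi> (k n) v) \<longlonglongrightarrow> lim (\<lambda>n. \<phi> (k n) v)"
    using Cauchy_convergent_iff convergent_LIMSEQ_iff by blast
  then show ?thesis using that[OF k(1), of "\<lambda>v. lim (\<lambda>n. \<phi> (k n) v)"] by blast
qed

end

locale converging_potentials = converging_transports \<phi> G \<nu> \<phi>' G' \<nu>' \<U>
  for \<phi> :: "nat \<Rightarrow> 'a::euclidean_space \<Rightarrow> real" and G \<nu> \<phi>' G' \<nu>' \<U> +
  fixes \<psi> :: "'a \<Rightarrow> real"
  assumes pot_lim: "\<And>v. v \<in> ball 0 1 \<Longrightarrow> (\<lambda>n. \<phi> n v) \<longlonglongrightarrow> \<psi> v"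
begin

section \<open>Identification of the limiting potential\<close>

lemma cvx_limit: "convex_on (ball 0 1) \<psi>"
proof (rule convex_onI)
  fix t :: real and x y :: 'a assume t: "0 < t" "t < 1" and xy: "x \<in> ball 0 1" "y \<in> ball 0 1"
  have "(1 - t) *\<^sub>R x + t *\<^sub>R y \<in> ball 0 1" using convexD_alt[OF convex_ball xy] t by simp
  then show "\<psi> ((1 - t) *\<^sub>R x + t *\<^sub>R y) \<le> (1 - t) * \<psi> x + t * \<psi> y"
    using xy t convex_onD[OF cvx _ _ xy] by (intro LIMSEQ_le[OF pot_lim tendsto_add[OF tendsto_mult_left[OF pot_lim] tendsto_mult_left[OF pot_lim]]]) auto
qed simp

text \<open>The common Lipschitz bound on a ball around 0 that contains \<open>l\<close> in its
  interior turns pointwise convergence into convergence at the moving points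
  \<open>u j\<close>.\<close>

lemma subgradient_limit:
  assumes k: "strict_mono (k::nat \<Rightarrow> nat)" and u: "u \<longlonglongrightarrow> l" "l \<in> ball 0 1" and x: "x \<longlonglongrightarrow> y"
    and sub: "\<And>j. x j \<in> subdifferential (\<phi> (k j)) (u j)"
  shows "y \<in> subdifferential \<psi> l"
proof (rule subdifferential_limit[OF _ _ u(1) x sub])
  have sublim: "(\<lambda>j. \<phi> (k j) v) \<longlonglongrightarrow> \<psi> v" if "v \<in> ball 0 1" for v
    using LIMSEQ_subseq_LIMSEQ[OF pot_lim[OF that] k] by (simp add: o_def)
  then show "v \<in> ball 0 1 \<Longrightarrow> (\<lambda>j. \<phi> (k j) v) \<longlonglongrightarrow> \<psi> v" for v .
  define r where "r = (1 + norm l) / 2"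
  have r: "r < 1" "norm l < r" using u(2) by (auto simp: r_def)
  obtain L N where L: "L \<ge> 0"
    "\<And>n u w. n \<ge> N \<Longrightarrow> u \<in> cball 0 r \<Longrightarrow> w \<in> cball 0 r \<Longrightarrow> \<bar>\<phi> n u - \<phi> n w\<bar> \<le> L * norm (u - w)"
    by (rule equi_Lipschitz[OF r(1)]) blast
  have "(\<lambda>j. \<phi> (k j) (u j) - \<phi> (k j) l) \<longlonglongrightarrow> 0"
  proof (rule tendsto_rabs_zero_cancel, rule tendsto_sandwich[of "\<lambda>_. 0" _ _ "\<lambda>j. L * norm (u j - l)"])
    show "(\<lambda>j. L * norm (u j - l)) \<longlonglongrightarrow> 0"
      using tendsto_mult_left[OF tendsto_norm_zero[OF LIM_zero[OF u(1)]], of L] by simp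
    have "\<forall>\<^sub>F j in sequentially. norm (u j) < r"
      by (rule order_tendstoD(2)[OF tendsto_norm[OF u(1)] r(2)])
    then show "\<forall>\<^sub>F j in sequentially. \<bar>\<phi> (k j) (u j) - \<phi> (k j) l\<bar> \<le> L * norm (u j - l)"
      using eventually_ge_at_top[of N]
    proof eventually_elim
      case (elim j)
      then have "N \<le> k j" using seq_suble[OF k, of j] by simp
      then show ?case using L(2)[of "k j" "u j" l] elim r by simp
    qed
  qed (auto intro: always_eventually)
  from tendsto_add[OF this sublim[OF u(2)]]
  show "(\<lambda>j. \<phi> (k j) (u j)) \<longlonglongrightarrow> \<psi> l" by simp
qed

text \<open>A point at which infinitely many of the transports hit \<open>U\<close> has a subgradient in its closure,
  by compactness; the rest is continuity of the measure along decreasing sequences.\<close>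
lemma limit_measure_le_open:
  assumes U: "U \<in> \<U>"
  shows "measure \<nu>' U \<le> prob {u \<in> ball 0 1. subdifferential \<psi> u \<inter> closure U \<noteq> {}}"
proof -
  define A where "A n = (\<Union>m\<in>{n..}. {u. G m u \<in> U})" for n
  have [measurable]: "U \<in> sets borel" using opn[OF U] by simp
  have Am: "A n \<in> events" for n unfolding A_def by measurable
  have "measure \<nu>' U \<le> prob (A n)" for n
  proof (rule LIMSEQ_le_const2[OF conv[OF U]], intro exI[of _ n] allI impI)
    fix m assume "n \<le> m"
    then show "measure (\<nu> m) U \<le> prob (A n)"
      unfolding measure_\<nu>[OF \<open>U \<in> sets borel\<close>] using Am
      by (intro finite_measure_mono) (auto simp: A_def)
  qed
  moreover have "(\<lambda>n. prob (A n)) \<longlonglongrightarrow> prob (\<Inter>n. A n)"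
    using Am by (intro finite_Lim_measure_decseq) (fastforce simp: decseq_def A_def)+
  ultimately have "measure \<nu>' U \<le> prob (\<Inter>n. A n)" by (intro LIMSEQ_le_const) auto
  also have "\<dots> \<le> prob {u \<in> ball 0 1. subdifferential \<psi> u \<inter> closure U \<noteq> {}}"
  proof (rule finite_measure_mono_AE)
    have "AE u in spherical_uniform. \<forall>n. u \<in> ball 0 1 \<and> G n u \<in> subdifferential (\<phi> n) u"
      using G_AE by (simp add: AE_all_countable)
    then show "AE u in spherical_uniform. u \<in> (\<Inter>n. A n) \<longrightarrow> u \<in> {u \<in> ball 0 1. subdifferential \<psi> u \<inter> closure U \<noteq> {}}"
    proof eventually_elim
      case (elim u)
      show ?case
      proof
        assume u: "u \<in> (\<Inter>n. A n)"
        have ub: "u \<in> ball 0 1" "norm u < 1" using elim by auto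
        obtain L N where L: "\<And>n w x. n \<ge> N \<Longrightarrow> w \<in> cball 0 (norm u) \<Longrightarrow> x \<in> subdifferential (\<phi> n) w \<Longrightarrow> norm x \<le> L"
          by (rule subgradients_bounded[OF ub(2)]) blast
        \<comment> \<open>Keeping only \<open>m \<ge> N\<close> places the chosen subgradients in
          \<open>cball 0 L\<close>, where a subsequence converges.\<close>
        have "infinite {m. G m u \<in> U \<and> N \<le> m}"
          unfolding infinite_nat_iff_unbounded_le
        proof
          fix n
          have "u \<in> A (max n N)" using u by blast
          then show "\<exists>m\<ge>n. m \<in> {m. G m u \<in> U \<and> N \<le> m}" by (auto simp: A_def)
        qed
        then obtain k where k: "strict_mono (k::nat \<Rightarrow> nat)" "\<And>j. G (k j) u \<in> U \<and> N \<le> k j"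
          using infinite_enumerate[of "{m. G m u \<in> U \<and> N \<le> m}"] by auto
        have "\<forall>j. G (k j) u \<in> cball 0 L"
          using L[of "k j" u "G (k j) u" for j] k(2) elim by simp
        then obtain y s where y: "strict_mono (s::nat \<Rightarrow> nat)" "((\<lambda>j. G (k j) u) \<circ> s) \<longlonglongrightarrow> y"
          using seq_compactE[OF compact_imp_seq_compact[OF compact_cball[of "0::'a" L]]] by metis
        have "y \<in> subdifferential \<psi> u"
          by (rule subgradient_limit[OF strict_mono_o[OF k(1) y(1)] tendsto_const ub(1) y(2)]) (use elim in auto)
        moreover have "y \<in> closure U"
          using y(2) k(2) unfolding closure_sequential by (intro exI[of _ "(\<lambda>j. G (k j) u) \<circ> s"]) auto
        ultimately show "u \<in> {u \<in> ball 0 1. subdifferential \<psi> u \<inter> closure U \<noteq> {}}" using ub by auto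
      qed
    qed
  qed (use subdifferential_preimage_borel[OF cvx_limit, of "closure U"] in auto)
  finally show ?thesis .
qed

text \<open>Members of \<open>\<U>\<close> squeezed into shrinking neighbourhoods of
  \<open>F\<close> reduce this to the open case. A point in every \<open>H n\<close> has
  subgradients arbitrarily close to \<open>F\<close>, and two disjoint compact sets have positive
  distance.\<close>

lemma limit_measure_le_compact:
  assumes F: "compact F"
  shows "measure \<nu>' F \<le> prob {u \<in> ball 0 1. subdifferential \<psi> u \<inter> F \<noteq> {}}"
\<comment> \<open>The empty set is split off because \<open>infdist\<close> to it is 0 by
  convention, so the neighbourhoods below would be the whole space.\<close>
proof (cases "F = {}")
  case False
  interpret N: prob_space \<nu>' by (rule prob_\<nu>)
  define H where "H n = {u \<in> ball 0 1. subdifferential \<psi> u \<inter> {x. infdist x F \<le> 1 / real (Suc n)} \<noteq> {}}" for n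
  have cl: "closed {x. infdist x F \<le> e}" for e
    by (intro closed_Collect_le continuous_intros)
  have Hm: "H n \<in> events" for n
    unfolding H_def using subdifferential_preimage_borel[OF cvx_limit cl] by simp
  have "measure \<nu>' F \<le> prob (H n)" for n
  proof -
    have "open {x. infdist x F < 1 / real (Suc n)}"
      by (intro open_Collect_less continuous_intros)
    moreover have "F \<subseteq> {x. infdist x F < 1 / real (Suc n)}" by auto
    ultimately obtain U where U: "U \<in> \<U>" "F \<subseteq> U" "U \<subseteq> {x. infdist x F < 1 / real (Suc n)}"
      using sep[OF F] by blast
    have cU: "closure U \<subseteq> {x. infdist x F \<le> 1 / real (Suc n)}"
      using U(3) by (intro closure_minimal cl) auto
    have "measure \<nu>' F \<le> measure \<nu>' U"
      using U opn[OF U(1)] by (intro N.finite_measure_mono) auto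
    also have "\<dots> \<le> prob {u \<in> ball 0 1. subdifferential \<psi> u \<inter> closure U \<noteq> {}}"
      by (rule limit_measure_le_open[OF U(1)])
    also have "\<dots> \<le> prob (H n)"
      using cU Hm by (intro finite_measure_mono) (auto simp: H_def)
    finally show ?thesis .
  qed
  moreover have "(\<lambda>n. prob (H n)) \<longlonglongrightarrow> prob (\<Inter>n. H n)"
  proof (rule finite_Lim_measure_decseq)
    have "1 / real (Suc n) \<le> 1 / real (Suc m)" if "m \<le> n" for m n
      using that by (intro divide_left_mono) auto
    then show "decseq H" unfolding decseq_def H_def by (fastforce intro: order_trans)
  qed (use Hm in auto)
  ultimately have "measure \<nu>' F \<le> prob (\<Inter>n. H n)" by (intro LIMSEQ_le_const) auto
  also have "\<dots> \<le> prob {u \<in> ball 0 1. subdifferential \<psi> u \<inter> F \<noteq> {}}"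
  proof (rule finite_measure_mono)
    show "(\<Inter>n. H n) \<subseteq> {u \<in> ball 0 1. subdifferential \<psi> u \<inter> F \<noteq> {}}"
    proof
      fix u assume u: "u \<in> (\<Inter>n. H n)"
      have ub: "u \<in> ball 0 1" using u by (auto simp: H_def)
      have "subdifferential \<psi> u \<inter> F \<noteq> {}"
      proof
        assume "subdifferential \<psi> u \<inter> F = {}"
        moreover have "compact (subdifferential \<psi> u)"
          using compact_subdifferential_image[OF cvx_limit, of "{u}"] ub by simp
        ultimately obtain d where d: "d > 0" "\<And>x y. x \<in> subdifferential \<psi> u \<Longrightarrow> y \<in> F \<Longrightarrow> d \<le> dist x y"
          using separate_compact_closed[OF _ compact_imp_closed[OF F]] by metis
        obtain n where n: "inverse (real (Suc n)) < d" using reals_Archimedean[OF d(1)] by blast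
        obtain x where x: "x \<in> subdifferential \<psi> u" "infdist x F \<le> 1 / real (Suc n)"
          using u by (auto simp: H_def)
        obtain y where "y \<in> F" "infdist x F = dist x y"
          using infdist_attains_inf[OF compact_imp_closed[OF F] False] by blast
        then show False using d(2)[OF x(1)] x(2) n by (fastforce simp: inverse_eq_divide)
      qed
      then show "u \<in> {u \<in> ball 0 1. subdifferential \<psi> u \<inter> F \<noteq> {}}" using ub by simp
    qed
  qed (use subdifferential_preimage_borel[OF cvx_limit compact_imp_closed[OF F]] in auto)
  finally show ?thesis .
qed simp

text \<open>For compact \<open>C\<close>, the map \<open>G'\<close> sends almost all of
  \<open>C\<close> into its image under the subdifferential of \<open>\<phi>'\<close>; bounding the
  limiting mass of that compact image through \<open>\<psi>\<close> gives the domination that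
  Aleksandrov's lemma asks for.\<close>

lemma limit_subdifferential_eq:
  assumes "u \<in> ball 0 1"
  shows "subdifferential \<psi> u = subdifferential \<phi>' u"
proof (rule subdifferential_eq_if_meet[OF _ assms, symmetric])
  fix p :: 'a assume p: "p \<in> ball 0 1"
  show "subdifferential \<phi>' p \<inter> subdifferential \<psi> p \<noteq> {}"
  proof (rule subdifferentials_meet[OF cvx' cvx_limit _ p])
    fix C :: "'a set" assume C: "compact C" "C \<subseteq> ball 0 1"
    let ?F = "\<Union>v\<in>C. subdifferential \<phi>' v"
    have F: "compact ?F" by (rule compact_subdifferential_image[OF cvx' C])
    then have [measurable]: "?F \<in> sets borel" by (rule borel_compact)
    have "prob C \<le> prob {u. G' u \<in> ?F}"
    proof (rule finite_measure_mono_AE)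
      show "AE u in spherical_uniform. u \<in> C \<longrightarrow> u \<in> {u. G' u \<in> ?F}"
        using G'_AE by eventually_elim auto
    qed measurable
    also have "\<dots> = measure \<nu>' ?F" unfolding distr_G' by (subst measure_distr) (auto simp: vimage_def)
    also have "\<dots> \<le> prob {u \<in> ball 0 1. subdifferential \<psi> u \<inter> ?F \<noteq> {}}"
      by (rule limit_measure_le_compact[OF F])
    finally show "emeasure spherical_uniform C \<le> emeasure spherical_uniform {u \<in> ball 0 1. subdifferential \<psi> u \<inter> ?F \<noteq> {}}"
      by (simp add: emeasure_eq_measure)
  qed
qed

end

context converging_transports begin

lemma region_closed:
  assumes \<tau>: "\<tau> < 1" and u: "\<And>n. u n \<in> cball 0 \<tau>" and x: "\<And>n. x n \<in> subdifferential (\<phi> n) (u n)"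
    and lim: "x \<longlonglongrightarrow> y"
  shows "y \<in> (\<Union>v\<in>cball 0 \<tau>. subdifferential \<phi>' v)"
proof -
  \<comment> \<open>Subtracting the value at 0 enables the extraction of a convergent subsequence
    and changes neither the subdifferentials nor the transports.\<close>
  define \<eta> where "\<eta> n v = \<phi> n v + - \<phi> n 0" for n v
  have sub\<eta>: "subdifferential (\<eta> n) v = subdifferential (\<phi> n) v" for n v
    by (auto simp: subdifferential_def \<eta>_def)
  interpret C: converging_transports \<eta> G \<nu> \<phi>' G' \<nu>' \<U>
    using sep opn tr' conv subgradient_transport_add_const[OF tr]
    unfolding \<eta>_def[abs_def] by unfold_locales
  obtain k \<psi> where k: "strict_mono (k::nat \<Rightarrow> nat)" "\<And>v. v \<in> ball 0 1 \<Longrightarrow> (\<lambda>n. \<eta> (k n) v) \<longlonglongrightarrow> \<psi> v"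
    by (rule C.convergent_subsequence) (auto simp: \<eta>_def)
  interpret P: converging_potentials "\<lambda>n. \<eta> (k n)" "\<lambda>n. G (k n)" "\<lambda>n. \<nu> (k n)" \<phi>' G' \<nu>' \<U> \<psi>
    using sep opn tr' C.tr k(2) LIMSEQ_subseq_LIMSEQ[OF conv k(1)]
    by unfold_locales (auto simp: o_def)
  obtain l s where s: "l \<in> cball 0 \<tau>" "strict_mono (s::nat \<Rightarrow> nat)" "((u \<circ> k) \<circ> s) \<longlonglongrightarrow> l"
    by (rule seq_compactE[OF compact_imp_seq_compact[OF compact_cball[of "0::'a" \<tau>]], of "u \<circ> k"]) (use u in auto)
  have lb: "l \<in> ball 0 1" using s(1) \<tau> by simp
  have "y \<in> subdifferential \<psi> l"
  proof (rule P.subgradient_limit[OF s(2,3) lb])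
    show "(x \<circ> (k \<circ> s)) \<longlonglongrightarrow> y" by (rule LIMSEQ_subseq_LIMSEQ[OF lim strict_mono_o[OF k(1) s(2)]])
    show "(x \<circ> (k \<circ> s)) j \<in> subdifferential (\<eta> (k (s j))) ((u \<circ> k \<circ> s) j)" for j
      using x by (simp add: sub\<eta>)
  qed
  then show ?thesis using P.limit_subdifferential_eq[OF lb] s(1) by auto
qed

end

section \<open>Disintegration along a regular conditional distribution\<close>

text \<open>For a fixed \<open>B\<close> the kernel is a version of the conditional probability;
  integrating over \<open>A\<close> absorbs the exceptional null set, which depends on
  \<open>B\<close>.\<close>

lemma regular_cond_distr_rectangle:
  fixes Y :: "'w \<Rightarrow> 'a::euclidean_space"
  assumes M: "prob_space M" and sub: "subalgebra M N" and Y [measurable]: "Y \<in> borel_measurable M"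
    and K: "is_regular_cond_distr M N Y K" and A: "A \<in> sets N" and B [measurable]: "B \<in> sets borel"
  shows "emeasure M {\<omega> \<in> space M. \<omega> \<in> A \<and> Y \<omega> \<in> B} = (\<integral>\<^sup>+ \<omega>. indicator A \<omega> * emeasure (K \<omega>) B \<partial>M)"
proof -
  interpret prob_space M by (rule M)
  interpret S: finite_measure_subalgebra M N by unfold_locales (rule sub)
  have KN: "K \<in> measurable N (prob_algebra borel)"
    and cond: "AE \<omega> in M. measure (K \<omega>) B = real_cond_exp M N (indicator (Y -` B \<inter> space M)) \<omega>"
    using K B by (auto simp: is_regular_cond_distr_def)
  have [measurable]: "A \<in> sets M" using A sub by (auto simp: subalgebra_def)
  have KM: "K \<in> measurable M (prob_algebra borel)"
    by (rule measurable_from_subalg[OF sub KN])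
  have [measurable]: "(\<lambda>\<omega>. measure (K \<omega>) B) \<in> borel_measurable M"
    using measurable_compose[OF measurable_prob_algebraD[OF KM] measurable_measure_subprob_algebra[OF B]] .
  have pK: "prob_space (K \<omega>)" if "\<omega> \<in> space M" for \<omega>
    using measurable_space[OF KM that] by (simp add: space_prob_algebra)
  have Kle: "measure (K \<omega>) B \<le> 1" if "\<omega> \<in> space M" for \<omega>
    using pK[OF that] prob_space.prob_le_1 by blast
  have int: "integrable M (\<lambda>\<omega>. indicator A \<omega> * measure (K \<omega>) B)"
    using Kle by (intro integrable_const_bound[of _ 1] AE_I2) (auto simp: indicator_def)
  have "measure M {\<omega> \<in> space M. \<omega> \<in> A \<and> Y \<omega> \<in> B} = (\<integral>\<omega>\<in>A. indicator (Y -` B \<inter> space M) \<omega> \<partial>M)"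
  proof -
    have "(\<integral>\<omega>\<in>A. indicat_real (Y -` B \<inter> space M) \<omega> \<partial>M)
      = (\<integral>\<omega>. indicator {\<omega> \<in> space M. \<omega> \<in> A \<and> Y \<omega> \<in> B} \<omega> \<partial>M)"
      unfolding set_lebesgue_integral_def
      by (intro Bochner_Integration.integral_cong) (auto simp: indicator_def)
    then show ?thesis by (simp add: Int_absorb2[OF Collect_subset])
  qed
  also have "\<dots> = (\<integral>\<omega>\<in>A. real_cond_exp M N (indicator (Y -` B \<inter> space M)) \<omega> \<partial>M)"
    by (rule S.real_cond_exp_intA[OF _ A]) (auto intro!: integrable_const_bound[of _ 1])
  also have "\<dots> = (\<integral>\<omega>. indicator A \<omega> * measure (K \<omega>) B \<partial>M)"
    unfolding set_lebesgue_integral_def using cond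
    by (intro integral_cong_AE) (auto elim: eventually_mono intro: borel_measurable_cond_exp2)
  finally have "emeasure M {\<omega> \<in> space M. \<omega> \<in> A \<and> Y \<omega> \<in> B} = ennreal (\<integral>\<omega>. indicator A \<omega> * measure (K \<omega>) B \<partial>M)"
    by (simp add: emeasure_eq_measure)
  also have "\<dots> = (\<integral>\<^sup>+ \<omega>. ennreal (indicator A \<omega> * measure (K \<omega>) B) \<partial>M)"
    by (rule nn_integral_eq_integral[symmetric, OF int]) auto
  also have "\<dots> = (\<integral>\<^sup>+ \<omega>. indicator A \<omega> * emeasure (K \<omega>) B \<partial>M)"
    using prob_space.finite_measure[OF pK]
    by (intro nn_integral_cong) (auto simp: indicator_def finite_measure.emeasure_eq_measure)
  finally show ?thesis .
qed

text \<open>The quantile region varies with \<open>\<omega>\<close>, so the identity for fixed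
  \<open>B\<close> has to be extended from rectangles to jointly measurable sets, here by Dynkin
  induction.\<close>

lemma regular_cond_distr_joint:
  fixes Y :: "'w \<Rightarrow> 'a::euclidean_space"
  assumes M: "prob_space M" and sub: "subalgebra M N" and Y [measurable]: "Y \<in> borel_measurable M"
    and K: "is_regular_cond_distr M N Y K" and C: "C \<in> sets (N \<Otimes>\<^sub>M borel)"
  shows "emeasure M {\<omega> \<in> space M. (\<omega>, Y \<omega>) \<in> C} = (\<integral>\<^sup>+ \<omega>. emeasure (K \<omega>) (Pair \<omega> -` C) \<partial>M)"
proof -
  interpret prob_space M by (rule M)
  have KN: "K \<in> measurable N (prob_algebra borel)"
    using K by (auto simp: is_regular_cond_distr_def)
  have spN [simp]: "space N = space M" using sub by (simp add: subalgebra_def)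
  have pK: "prob_space (K \<omega>)" "sets (K \<omega>) = sets borel" "space (K \<omega>) = UNIV" if "\<omega> \<in> space M" for \<omega>
    using measurable_space[OF KN, of \<omega>] that by (auto simp: space_prob_algebra dest: sets_eq_imp_space_eq)
  have idY: "(\<lambda>\<omega>. (\<omega>, Y \<omega>)) \<in> measurable M (N \<Otimes>\<^sub>M borel)"
    by (intro measurable_Pair Y measurable_from_subalg[OF sub]) (auto intro: measurable_ident_sets)
  have ev: "{\<omega> \<in> space M. (\<omega>, Y \<omega>) \<in> D} \<in> events" if "D \<in> sets (N \<Otimes>\<^sub>M borel)" for D
    using measurable_sets[OF idY that] by (simp add: vimage_def Int_def conj_commute)
  have meas: "(\<lambda>\<omega>. emeasure (K \<omega>) (Pair \<omega> -` D)) \<in> borel_measurable M" if D: "D \<in> sets (N \<Otimes>\<^sub>M borel)" for D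
  proof (rule measurable_from_subalg[OF sub])
    have "(SIGMA \<omega>:space N. Pair \<omega> -` D) = D"
      using sets.sets_into_space[OF D] by (auto simp: space_pair_measure)
    then show "(\<lambda>\<omega>. emeasure (K \<omega>) (Pair \<omega> -` D)) \<in> borel_measurable N"
      using D by (intro emeasure_measurable_subprob_algebra2[where N=borel] measurable_prob_algebraD[OF KN]) simp
  qed
  have sec: "Pair \<omega> -` D \<in> sets borel" if "D \<in> sets (N \<Otimes>\<^sub>M borel)" for D and \<omega>
    by (rule sets_Pair1[OF that])
  let ?G = "{a \<times> b | a b. a \<in> sets N \<and> b \<in> sets (borel :: 'a measure)}"
  have pair: "sets (N \<Otimes>\<^sub>M (borel :: 'a measure)) = sigma_sets (space N \<times> UNIV) ?G"
    by (simp add: sets_pair_measure)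
  have Pow: "?G \<subseteq> Pow (space N \<times> UNIV)" using sets.sets_into_space[of _ N] by auto
  have "C \<in> sigma_sets (space N \<times> UNIV) ?G" using C pair by simp
  with Int_stable_pair_measure_generator Pow show ?thesis
  proof (induction rule: sigma_sets_induct_disjoint)
    case (basic R)
    then obtain A B where R: "R = A \<times> B" "A \<in> sets N" "B \<in> sets borel" by auto
    have "emeasure M {\<omega> \<in> space M. (\<omega>, Y \<omega>) \<in> R} = (\<integral>\<^sup>+ \<omega>. indicator A \<omega> * emeasure (K \<omega>) B \<partial>M)"
      using regular_cond_distr_rectangle[OF M sub Y K R(2,3)] R(1) by simp
    also have "\<dots> = (\<integral>\<^sup>+ \<omega>. emeasure (K \<omega>) (Pair \<omega> -` R) \<partial>M)"
      by (intro nn_integral_cong) (auto simp: R(1) indicator_def vimage_def)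
    finally show ?case .
  next
    case (compl D)
    then have D: "D \<in> sets (N \<Otimes>\<^sub>M borel)" using pair by simp
    have "emeasure M {\<omega> \<in> space M. (\<omega>, Y \<omega>) \<in> space N \<times> UNIV - D} = emeasure M (space M - {\<omega> \<in> space M. (\<omega>, Y \<omega>) \<in> D})"
      by (intro arg_cong2[where f=emeasure]) auto
    also have "\<dots> = 1 - emeasure M {\<omega> \<in> space M. (\<omega>, Y \<omega>) \<in> D}"
      using ev[OF D] by (subst emeasure_compl) (auto simp: emeasure_space_1)
    also have "\<dots> = (\<integral>\<^sup>+ \<omega>. 1 \<partial>M) - (\<integral>\<^sup>+ \<omega>. emeasure (K \<omega>) (Pair \<omega> -` D) \<partial>M)"
      by (simp add: compl.IH emeasure_space_1)
    also have "\<dots> = (\<integral>\<^sup>+ \<omega>. 1 - emeasure (K \<omega>) (Pair \<omega> -` D) \<partial>M)"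
    proof (rule nn_integral_diff[symmetric])
      show "(\<integral>\<^sup>+ \<omega>. emeasure (K \<omega>) (Pair \<omega> -` D) \<partial>M) \<noteq> \<infinity>"
        unfolding compl.IH[symmetric] by simp
      show "AE \<omega> in M. emeasure (K \<omega>) (Pair \<omega> -` D) \<le> 1"
        using pK by (intro AE_I2) (auto intro: prob_space.measure_le_1)
    qed (use meas[OF D] in auto)
    also have "\<dots> = (\<integral>\<^sup>+ \<omega>. emeasure (K \<omega>) (Pair \<omega> -` (space N \<times> UNIV - D)) \<partial>M)"
    proof (rule nn_integral_cong)
      fix \<omega> assume w: "\<omega> \<in> space M"
      interpret k: prob_space "K \<omega>" by (rule pK[OF w])
      have "Pair \<omega> -` (space N \<times> UNIV - D) = space (K \<omega>) - Pair \<omega> -` D" using w pK(3)[OF w] by auto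
      then show "1 - emeasure (K \<omega>) (Pair \<omega> -` D) = emeasure (K \<omega>) (Pair \<omega> -` (space N \<times> UNIV - D))"
        using sec[OF D] pK(2)[OF w] k.emeasure_space_1 by (simp add: emeasure_compl)
    qed
    finally show ?case .
  next
    case (union D)
    then have D: "D i \<in> sets (N \<Otimes>\<^sub>M borel)" for i using pair by auto
    have "emeasure M {\<omega> \<in> space M. (\<omega>, Y \<omega>) \<in> (\<Union>i. D i)} = emeasure M (\<Union>i. {\<omega> \<in> space M. (\<omega>, Y \<omega>) \<in> D i})"
      by (intro arg_cong2[where f=emeasure]) auto
    also have "\<dots> = (\<Sum>i. emeasure M {\<omega> \<in> space M. (\<omega>, Y \<omega>) \<in> D i})"
      using ev[OF D] union(1) by (intro suminf_emeasure[symmetric]) (auto simp: disjoint_family_on_def)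
    also have "\<dots> = (\<Sum>i. \<integral>\<^sup>+ \<omega>. emeasure (K \<omega>) (Pair \<omega> -` D i) \<partial>M)"
      by (simp add: union.IH)
    also have "\<dots> = (\<integral>\<^sup>+ \<omega>. (\<Sum>i. emeasure (K \<omega>) (Pair \<omega> -` D i)) \<partial>M)"
      by (intro nn_integral_suminf[symmetric] meas D)
    also have "\<dots> = (\<integral>\<^sup>+ \<omega>. emeasure (K \<omega>) (Pair \<omega> -` (\<Union>i. D i)) \<partial>M)"
    proof (rule nn_integral_cong)
      fix \<omega> assume w: "\<omega> \<in> space M"
      have "disjoint_family (\<lambda>i. Pair \<omega> -` D i)"
        using union(1) unfolding disjoint_family_on_def by blast
      then show "(\<Sum>i. emeasure (K \<omega>) (Pair \<omega> -` D i)) = emeasure (K \<omega>) (Pair \<omega> -` (\<Union>i. D i))"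
        unfolding vimage_UN using sec[OF D] pK(2)[OF w] by (intro suminf_emeasure) auto
    qed
    finally show ?case .
  qed simp
qed

text \<open>Conditioning on \<open>A \<in> N\<close> amounts to intersecting \<open>C\<close> with \<open>A \<times> UNIV\<close>.\<close>
lemma real_cond_exp_regular:
  fixes Y :: "'w \<Rightarrow> 'a::euclidean_space"
  assumes M: "prob_space M" and sub: "subalgebra M N" and Y [measurable]: "Y \<in> borel_measurable M"
    and K: "is_regular_cond_distr M N Y K" and C: "C \<in> sets (N \<Otimes>\<^sub>M borel)"
  shows "{\<omega> \<in> space M. (\<omega>, Y \<omega>) \<in> C} \<in> sets M"
    and "AE \<omega> in M. real_cond_exp M N (indicator {\<omega> \<in> space M. (\<omega>, Y \<omega>) \<in> C}) \<omega> = measure (K \<omega>) (Pair \<omega> -` C)"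
proof -
  interpret prob_space M by (rule M)
  interpret S: finite_measure_subalgebra M N by unfold_locales (rule sub)
  have KN: "K \<in> measurable N (prob_algebra borel)"
    using K by (auto simp: is_regular_cond_distr_def)
  have spN [simp]: "space N = space M" using sub by (simp add: subalgebra_def)
  have pK: "prob_space (K \<omega>)" if "\<omega> \<in> space M" for \<omega>
    using measurable_space[OF KN, of \<omega>] that by (auto simp: space_prob_algebra)
  have idY: "(\<lambda>\<omega>. (\<omega>, Y \<omega>)) \<in> measurable M (N \<Otimes>\<^sub>M borel)"
    by (intro measurable_Pair Y measurable_from_subalg[OF sub]) (auto intro: measurable_ident_sets)
  have ev: "{\<omega> \<in> space M. (\<omega>, Y \<omega>) \<in> D} \<in> events" if "D \<in> sets (N \<Otimes>\<^sub>M borel)" for D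
    using measurable_sets[OF idY that] by (simp add: vimage_def Int_def conj_commute)
  show ev_C: "{\<omega> \<in> space M. (\<omega>, Y \<omega>) \<in> C} \<in> sets M" by (rule ev[OF C])
  let ?g = "\<lambda>\<omega>. measure (K \<omega>) (Pair \<omega> -` C)"
  have "(SIGMA \<omega>:space N. Pair \<omega> -` C) = C"
    using sets.sets_into_space[OF C] by (auto simp: space_pair_measure)
  then have "(\<lambda>\<omega>. emeasure (K \<omega>) (Pair \<omega> -` C)) \<in> borel_measurable N"
    using C by (intro emeasure_measurable_subprob_algebra2[where N=borel] measurable_prob_algebraD[OF KN]) simp
  then have gN: "?g \<in> borel_measurable N" unfolding measure_def by measurable
  have gM [measurable]: "?g \<in> borel_measurable M" by (rule measurable_from_subalg[OF sub gN])
  have g1: "?g \<omega> \<le> 1" if "\<omega> \<in> space M" for \<omega>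
    using pK[OF that] prob_space.prob_le_1 by blast
  have g_int: "integrable M ?g"
    using g1 by (intro integrable_const_bound[of _ 1] AE_I2) auto
  show "AE \<omega> in M. real_cond_exp M N (indicator {\<omega> \<in> space M. (\<omega>, Y \<omega>) \<in> C}) \<omega> = ?g \<omega>"
  proof (rule S.real_cond_exp_charact[OF _ _ g_int gN])
    show "integrable M (indicat_real {\<omega> \<in> space M. (\<omega>, Y \<omega>) \<in> C})"
      using ev_C by (intro integrable_const_bound[of _ 1]) auto
    fix A assume A: "A \<in> sets N"
    have AM [measurable]: "A \<in> sets M" using A sub by (auto simp: subalgebra_def)
    let ?D = "C \<inter> (A \<times> UNIV)"
    have D: "?D \<in> sets (N \<Otimes>\<^sub>M borel)" using A by (intro sets.Int C pair_measureI) auto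
    have Ag: "integrable M (\<lambda>\<omega>. indicator A \<omega> * ?g \<omega>)"
      using g1 by (intro integrable_const_bound[of _ 1] AE_I2) (auto simp: indicator_def)
    have "(\<integral>\<omega>\<in>A. indicat_real {\<omega> \<in> space M. (\<omega>, Y \<omega>) \<in> C} \<omega> \<partial>M)
        = (\<integral>\<omega>. indicator {\<omega> \<in> space M. (\<omega>, Y \<omega>) \<in> ?D} \<omega> \<partial>M)"
      unfolding set_lebesgue_integral_def
      by (intro Bochner_Integration.integral_cong) (auto simp: indicator_def)
    also have "\<dots> = measure M {\<omega> \<in> space M. (\<omega>, Y \<omega>) \<in> ?D}"
      by (simp add: Int_absorb2[OF Collect_subset])
    also have "\<dots> = (\<integral>\<omega>. indicator A \<omega> * ?g \<omega> \<partial>M)"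
    proof -
      have "ennreal (measure M {\<omega> \<in> space M. (\<omega>, Y \<omega>) \<in> ?D}) = (\<integral>\<^sup>+ \<omega>. emeasure (K \<omega>) (Pair \<omega> -` ?D) \<partial>M)"
        using regular_cond_distr_joint[OF M sub Y K D] by (simp add: emeasure_eq_measure)
      also have "\<dots> = (\<integral>\<^sup>+ \<omega>. ennreal (indicator A \<omega> * ?g \<omega>) \<partial>M)"
        using prob_space.finite_measure[OF pK]
        by (intro nn_integral_cong) (auto simp: indicator_def finite_measure.emeasure_eq_measure vimage_def)
      also have "\<dots> = ennreal (\<integral>\<omega>. indicator A \<omega> * ?g \<omega> \<partial>M)"
        by (rule nn_integral_eq_integral[OF Ag]) auto
      finally show ?thesis by (subst (asm) ennreal_inj) (auto intro!: integral_nonneg_AE)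
    qed
    finally show "(\<integral>\<omega>\<in>A. indicator {\<omega> \<in> space M. (\<omega>, Y \<omega>) \<in> C} \<omega> \<partial>M) = (\<integral>\<omega>\<in>A. ?g \<omega> \<partial>M)"
      unfolding set_lebesgue_integral_def by simp
  qed
qed

section \<open>Mass of the quantile regions\<close>

text \<open>Averaging \<open>N\<close> over the translates along \<open>b\<close> reduces the claim to the null sections, by Fubini.\<close>
lemma null_set_if_null_lines:
  fixes N :: "'a::euclidean_space set" and b :: 'a
  assumes N [measurable]: "N \<in> sets borel"
    and lines: "\<And>y. emeasure lborel {s::real. y + s *\<^sub>R b \<in> N} = 0"
  shows "N \<in> null_sets lborel"
proof -
  have tr: "(\<integral>\<^sup>+ y. indicator N (y + c) \<partial>lborel) = emeasure lborel N" for c :: 'a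
  proof -
    have "emeasure lborel N = (\<integral>\<^sup>+ y. indicator N y \<partial>distr lborel borel ((+) c))"
      by (subst lborel_distr_plus) simp
    also have "\<dots> = (\<integral>\<^sup>+ y. indicator N (c + y) \<partial>lborel)" by (subst nn_integral_distr) auto
    finally show ?thesis by (simp add: add.commute)
  qed
  \<comment> \<open>The unit interval has length 1, so averaging over shifts \<open>s\<close> in it
    preserves the mass.\<close>
  have "emeasure lborel N = (\<integral>\<^sup>+ s. emeasure lborel N * indicator {0..1} s \<partial>(lborel :: real measure))"
    by (subst nn_integral_cmult_indicator) auto
  also have "\<dots> = (\<integral>\<^sup>+ s. (\<integral>\<^sup>+ y. indicator N (y + s *\<^sub>R b) * indicator {0..1} s \<partial>lborel) \<partial>(lborel :: real measure))"
    by (subst nn_integral_multc) (auto simp: tr)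
  also have "\<dots> = (\<integral>\<^sup>+ y. (\<integral>\<^sup>+ s. indicator N (y + s *\<^sub>R b) * indicator {0..1} s \<partial>(lborel :: real measure)) \<partial>lborel)"
    by (rule lborel_pair.Fubini') measurable
  also have "\<dots> \<le> (\<integral>\<^sup>+ y. (\<integral>\<^sup>+ s. indicator {s. y + s *\<^sub>R b \<in> N} s \<partial>(lborel :: real measure)) \<partial>lborel)"
    by (intro nn_integral_mono) (auto simp: indicator_def)
  also have "\<dots> = 0"
  proof -
    have "{s::real. y + s *\<^sub>R b \<in> N} \<in> sets borel" for y by measurable
    then show ?thesis using lines by simp
  qed
  finally show ?thesis by (auto simp: null_sets_def)
qed

text \<open>Two subgradients at \<open>y\<close> differ in some coordinate \<open>b\<close>;
  rationals \<open>p < q\<close> between the two coordinates place \<open>y\<close> in one of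
  countably many sets \<open>E b p q\<close>, each of which meets every line parallel to
  \<open>b\<close> in at most one point.\<close>

lemma distinct_subgradients_null:
  fixes f :: "'a::euclidean_space \<Rightarrow> real"
  assumes f: "continuous_on UNIV f"
  obtains N where "N \<in> null_sets lborel"
    "\<And>y u v. u \<noteq> v \<Longrightarrow> (\<And>z. f z \<ge> f y + inner u (z - y)) \<Longrightarrow> (\<And>z. f z \<ge> f y + inner v (z - y)) \<Longrightarrow> y \<in> N"
proof -
  define E where "E b p q = {y. \<forall>s::real. f (y + s *\<^sub>R b) \<ge> f y + p * s \<and> f (y + s *\<^sub>R b) \<ge> f y + q * s}" for b p q
  have E_null: "E b p q \<in> null_sets lborel" if pq: "p < q" for b p q
  proof (rule null_set_if_null_lines[of _ b])
    have "closed (E b p q)"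
      unfolding E_def
      by (intro closed_Collect_all closed_Collect_conj closed_Collect_le continuous_intros
          continuous_on_compose2[OF f]) auto
    then show "E b p q \<in> sets borel" by auto
    fix y :: 'a
    \<comment> \<open>Slope \<open>q\<close> forwards from \<open>s\<close> and slope
      \<open>p\<close> backwards from \<open>t\<close> would force the increment of \<open>f\<close>
      to be at least \<open>q * (t - s)\<close> and at most \<open>p * (t - s)\<close>.\<close>
    have le: "\<not> (s < t)" if st: "y + s *\<^sub>R b \<in> E b p q" "y + t *\<^sub>R b \<in> E b p q" for s t :: real
    proof
      assume "s < t"
      have "f (y + s *\<^sub>R b + (t - s) *\<^sub>R b) \<ge> f (y + s *\<^sub>R b) + q * (t - s)"
        "f (y + t *\<^sub>R b + (s - t) *\<^sub>R b) \<ge> f (y + t *\<^sub>R b) + p * (s - t)"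
        using st unfolding E_def by blast+
      moreover have "y + s *\<^sub>R b + (t - s) *\<^sub>R b = y + t *\<^sub>R b" "y + t *\<^sub>R b + (s - t) *\<^sub>R b = y + s *\<^sub>R b"
        by (simp_all add: algebra_simps)
      ultimately have "(q - p) * (t - s) \<le> 0" by (simp add: algebra_simps)
      then show False using pq \<open>s < t\<close> by (simp add: mult_le_0_iff)
    qed
    have "countable {s. y + s *\<^sub>R b \<in> E b p q}"
    proof (cases "\<exists>s. y + s *\<^sub>R b \<in> E b p q")
      case True
      then obtain s where s: "y + s *\<^sub>R b \<in> E b p q" by blast
      have "{s. y + s *\<^sub>R b \<in> E b p q} \<subseteq> {s}"
        using le[OF s] le[OF _ s] by (fastforce simp: not_less)
      then show ?thesis using countable_subset by blast
    qed auto
    then show "emeasure lborel {s. y + s *\<^sub>R b \<in> E b p q} = 0"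
      by (rule emeasure_lborel_countable)
  qed
  show ?thesis
  proof (rule that[of "\<Union>b\<in>Basis. \<Union>p\<in>\<rat>. \<Union>q\<in>\<rat>\<inter>{p<..}. E b p q"])
    show "(\<Union>b\<in>Basis. \<Union>p\<in>\<rat>. \<Union>q\<in>\<rat>\<inter>{p<..}. E b p q) \<in> null_sets lborel"
      by (intro null_sets_UN' countable_rat countable_Int1 E_null) (auto intro: countable_finite)
    have one: "\<exists>b\<in>Basis. \<exists>p\<in>\<rat>. \<exists>q\<in>\<rat>\<inter>{p<..}. y \<in> E b p q"
      if b: "b \<in> Basis" and lt: "inner u b < inner v b"
        and sub: "\<And>z. f z \<ge> f y + inner u (z - y)" "\<And>z. f z \<ge> f y + inner v (z - y)"
      for y u v b :: 'a
    proof -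
      obtain p where p: "p \<in> \<rat>" "inner u b < p" "p < inner v b" using Rats_dense_in_real[OF lt] by blast
      obtain q where q: "q \<in> \<rat>" "p < q" "q < inner v b" using Rats_dense_in_real[OF p(3)] by blast
      \<comment> \<open>For an intermediate slope \<open>r\<close>, the subgradient \<open>v\<close>
        gives the bound for \<open>s \<ge> 0\<close> and \<open>u\<close> gives it for
        \<open>s < 0\<close>.\<close>
      have "f (y + s *\<^sub>R b) \<ge> f y + r * s" if r: "inner u b < r" "r < inner v b" for r s
      proof (cases "s \<ge> 0")
        case True
        then have "r * s \<le> inner v b * s" using r by (intro mult_right_mono) auto
        then show ?thesis using sub(2)[of "y + s *\<^sub>R b"] by (simp add: mult.commute)
      next
        case False
        then have "r * s \<le> inner u b * s" using r by (intro mult_right_mono_neg) auto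
        then show ?thesis using sub(1)[of "y + s *\<^sub>R b"] by (simp add: mult.commute)
      qed
      then have "y \<in> E b p q" using p q unfolding E_def by auto
      then show ?thesis using b p q by blast
    qed
    fix y u v :: 'a
    assume uv: "u \<noteq> v" "\<And>z. f z \<ge> f y + inner u (z - y)" "\<And>z. f z \<ge> f y + inner v (z - y)"
    obtain b where b: "b \<in> Basis" "inner u b \<noteq> inner v b" using uv(1) euclidean_eqI by blast
    then consider "inner u b < inner v b" | "inner v b < inner u b" by linarith
    then have "\<exists>b\<in>Basis. \<exists>p\<in>\<rat>. \<exists>q\<in>\<rat>\<inter>{p<..}. y \<in> E b p q"
      by cases (rule one[OF b(1) _ uv(2,3)] one[OF b(1) _ uv(3,2)], assumption)+
    then show "y \<in> (\<Union>b\<in>Basis. \<Union>p\<in>\<rat>. \<Union>q\<in>\<rat>\<inter>{p<..}. E b p q)" by blast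
  qed
qed

text \<open>If \<open>y\<close> is a subgradient of \<open>\<phi>\<close> at \<open>u\<close>, then \<open>u\<close> is a subgradient at \<open>y\<close> of the conjugate of \<open>\<phi>\<close>, which
  is finite and Lipschitz because \<open>\<phi>\<close> lives on a bounded set and has an affine minorant.\<close>
lemma common_subgradients_null:
  fixes \<phi> :: "'a::euclidean_space \<Rightarrow> real"
  assumes \<phi>: "convex_on (ball 0 1) \<phi>"
  obtains N where "N \<in> null_sets lborel"
    "\<And>y u v. u \<in> ball 0 1 \<Longrightarrow> v \<in> ball 0 1 \<Longrightarrow> u \<noteq> v \<Longrightarrow>
      y \<in> subdifferential \<phi> u \<Longrightarrow> y \<in> subdifferential \<phi> v \<Longrightarrow> y \<in> N"
proof -
  define f where "f y = (SUP u\<in>ball 0 1. inner u y - \<phi> u)" for y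
  obtain x0 where x0: "x0 \<in> subdifferential \<phi> 0" using subdifferential_nonempty[OF \<phi>, of 0] by auto
  have bdd: "bdd_above ((\<lambda>u. inner u y - \<phi> u) ` ball 0 1)" for y
  proof (rule bdd_aboveI2)
    fix u :: 'a assume u: "u \<in> ball 0 1"
    have "inner u y - inner x0 u = inner (y - x0) u" by (simp add: inner_diff_left inner_commute[of u])
    also have "\<dots> \<le> norm (y - x0) * norm u" by (rule norm_cauchy_schwarz)
    also have "\<dots> \<le> norm (y - x0) * 1" using u by (intro mult_left_mono) auto
    finally show "inner u y - \<phi> u \<le> norm (y - x0) - \<phi> 0"
      using subdifferentialD[OF x0 u] by simp
  qed
  have upper: "inner u y - \<phi> u \<le> f y" if "u \<in> ball 0 1" for u y
    unfolding f_def using that by (intro cSUP_upper bdd)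
  have lip: "f y \<le> f z + dist y z" for y z
    unfolding f_def[of y]
  proof (rule cSUP_least)
    fix u :: 'a assume u: "u \<in> ball 0 1"
    have "inner u y = inner u z + inner u (y - z)" by (simp add: inner_diff_right)
    also have "inner u (y - z) \<le> norm u * norm (y - z)" by (rule norm_cauchy_schwarz)
    also have "\<dots> \<le> 1 * norm (y - z)" using u by (intro mult_right_mono) auto
    finally show "inner u y - \<phi> u \<le> f z + dist y z" using upper[OF u, of z] by (simp add: dist_norm)
  qed simp
  have "continuous_on UNIV f"
    unfolding continuous_on_iff
  proof (intro ballI allI impI)
    fix y :: 'a and e :: real assume "0 < e"
    moreover have "dist (f z) (f y) \<le> dist z y" for z
      using lip[of y z] lip[of z y] by (simp add: dist_real_def dist_commute abs_le_iff)
    ultimately show "\<exists>d>0. \<forall>z\<in>UNIV. dist z y < d \<longrightarrow> dist (f z) (f y) < e"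
      using le_less_trans by blast
  qed
  then obtain N where N: "N \<in> null_sets lborel"
    "\<And>y u v. u \<noteq> v \<Longrightarrow> (\<And>z. f z \<ge> f y + inner u (z - y)) \<Longrightarrow> (\<And>z. f z \<ge> f y + inner v (z - y)) \<Longrightarrow> y \<in> N"
    by (rule distinct_subgradients_null) blast
  \<comment> \<open>That \<open>y\<close> is a subgradient at \<open>u\<close> means that the
    supremum defining \<open>f y\<close> is attained at \<open>u\<close>; at any other
    \<open>z\<close> the same \<open>u\<close> still gives a lower bound.\<close>
  have dual: "f z \<ge> f y + inner u (z - y)" if u: "u \<in> ball 0 1" and y: "y \<in> subdifferential \<phi> u" for u y z
  proof -
    have "f y \<le> inner u y - \<phi> u"
      unfolding f_def
    proof (rule cSUP_least)
      fix w :: 'a assume "w \<in> ball 0 1"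
      from subdifferentialD[OF y this] show "inner w y - \<phi> w \<le> inner u y - \<phi> u"
        by (simp add: inner_diff_right inner_commute)
    qed simp
    then show ?thesis using upper[OF u, of z] by (simp add: inner_diff_right)
  qed
  show ?thesis
    by (rule that[OF N(1)], rule N(2)) (use dual in auto)
qed

lemma transport_region_measure:
  fixes \<nu> :: "'a::euclidean_space measure"
  assumes tr: "subgradient_transport \<phi> G \<nu>" and \<tau>: "0 < \<tau>" "\<tau> < 1"
  shows "measure \<nu> (\<Union>u\<in>cball 0 \<tau>. subdifferential \<phi> u) \<ge> \<tau>"
    and "absolutely_continuous lborel \<nu> \<Longrightarrow> measure \<nu> (\<Union>u\<in>cball 0 \<tau>. subdifferential \<phi> u) = \<tau>"
proof -
  interpret prob_space "spherical_uniform :: 'a measure" by (rule prob_space_spherical_uniform)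
  have \<phi>: "convex_on (ball 0 1) \<phi>" and [measurable]: "G \<in> borel_measurable borel"
    and G: "AE u in spherical_uniform. u \<in> ball 0 1 \<and> G u \<in> subdifferential \<phi> u"
    and \<nu>: "\<nu> = distr spherical_uniform borel G"
    using tr by (auto simp: subgradient_transport_def)
  let ?R = "\<Union>u\<in>cball 0 \<tau>. subdifferential \<phi> u"
  have "cball 0 \<tau> \<subseteq> ball (0::'a) 1" using \<tau> by auto
  then have [measurable]: "?R \<in> sets borel"
    by (intro borel_compact compact_subdifferential_image[OF \<phi>]) auto
  have \<nu>R: "measure \<nu> ?R = prob {u. G u \<in> ?R}"
    unfolding \<nu> by (subst measure_distr) (auto simp: vimage_def)
  have ball: "prob (cball 0 \<tau>) = \<tau>" using \<tau> by (intro measure_spherical_uniform_cball) auto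
  have "prob (cball 0 \<tau>) \<le> prob {u. G u \<in> ?R}"
  proof (rule finite_measure_mono_AE)
    show "AE u in spherical_uniform. u \<in> cball 0 \<tau> \<longrightarrow> u \<in> {u. G u \<in> ?R}"
      using G by eventually_elim auto
  qed measurable
  then show ge: "measure \<nu> ?R \<ge> \<tau>" by (simp add: \<nu>R ball)
  assume ac: "absolutely_continuous lborel \<nu>"
  obtain N where N: "N \<in> null_sets lborel"
    "\<And>y u v. u \<in> ball 0 1 \<Longrightarrow> v \<in> ball 0 1 \<Longrightarrow> u \<noteq> v \<Longrightarrow>
      y \<in> subdifferential \<phi> u \<Longrightarrow> y \<in> subdifferential \<phi> v \<Longrightarrow> y \<in> N"
    by (rule common_subgradients_null[OF \<phi>]) blast
  have "N \<in> null_sets (distr spherical_uniform borel G)"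
    using N(1) ac \<nu> by (auto simp: absolutely_continuous_def)
  then have notN: "AE u in spherical_uniform. G u \<notin> N"
    using AE_distrD[OF _ AE_not_in, of G spherical_uniform borel N] by simp
  have "prob {u. G u \<in> ?R} \<le> prob (cball 0 \<tau>)"
  proof (rule finite_measure_mono_AE)
    show "AE u in spherical_uniform. u \<in> {u. G u \<in> ?R} \<longrightarrow> u \<in> cball 0 \<tau>"
      using G notN
    proof eventually_elim
      case (elim u)
      show ?case
      proof
        assume "u \<in> {u. G u \<in> ?R}"
        then obtain v where v: "v \<in> cball 0 \<tau>" "G u \<in> subdifferential \<phi> v" by auto
        \<comment> \<open>Otherwise \<open>G u\<close> is a subgradient at two different points and
          lies in \<open>N\<close>.\<close>
        then have "u = v" using elim N(2)[of u v "G u"] \<open>cball 0 \<tau> \<subseteq> ball 0 1\<close> by blast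
        then show "u \<in> cball 0 \<tau>" using v by simp
      qed
    qed
  qed measurable
  then show "measure \<nu> ?R = \<tau>" using ge by (simp add: \<nu>R ball)
qed

section \<open>Measurability of the quantile regions\<close>

text \<open>The pairs \<open>(\<omega>, x)\<close> with \<open>x\<close> in the region form the preimage of a closed set under the measurable
  map recording \<open>x\<close> and the masses that \<open>K \<omega>\<close> gives to countably many open sets; the potentials
  themselves need not be chosen measurably in \<open>\<omega>\<close>.\<close>
lemma quantile_region_measurable:
  fixes K :: "'w \<Rightarrow> 'a::euclidean_space measure"
  assumes K: "K \<in> measurable N (prob_algebra borel)"
    and Q: "\<And>\<omega>. \<omega> \<in> space N \<Longrightarrow> is_quantile_map (K \<omega>) (Q \<omega>)" and \<tau>: "\<tau> < 1"
  shows "{p \<in> space (N \<Otimes>\<^sub>M borel). snd p \<in> quantile_region (Q (fst p)) \<tau>} \<in> sets (N \<Otimes>\<^sub>M borel)" (is "?C \<in> _")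
proof -
  have "\<forall>\<omega>\<in>space N. \<exists>\<phi> G. subgradient_transport \<phi> G (K \<omega>) \<and> (\<forall>u\<in>ball 0 1. Q \<omega> u = subdifferential \<phi> u)"
    using Q quantile_potential_imp_transport unfolding is_quantile_map_def by metis
  then obtain \<phi> G where tr: "\<And>\<omega>. \<omega> \<in> space N \<Longrightarrow> subgradient_transport (\<phi> \<omega>) (G \<omega>) (K \<omega>)"
    and Q\<phi>: "\<And>\<omega> u. \<omega> \<in> space N \<Longrightarrow> u \<in> ball 0 1 \<Longrightarrow> Q \<omega> u = subdifferential (\<phi> \<omega>) u" by metis
  have region: "quantile_region (Q \<omega>) \<tau> = (\<Union>u\<in>cball 0 \<tau>. subdifferential (\<phi> \<omega>) u)" if "\<omega> \<in> space N" for \<omega>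
    unfolding quantile_region_def using \<tau> by (intro SUP_cong Q\<phi> that) auto
  obtain \<U> :: "'a set set" where \<U>: "countable \<U>" "\<And>U. U \<in> \<U> \<Longrightarrow> open U"
    "\<And>F W. compact F \<Longrightarrow> open W \<Longrightarrow> F \<subseteq> W \<Longrightarrow> \<exists>U\<in>\<U>. F \<subseteq> U \<and> U \<subseteq> W"
    by (rule countable_separating_opens) blast
  have "\<U> \<noteq> {}" using \<U>(3)[of "{}" UNIV] by auto
  define e where "e = from_nat_into \<U>"
  have e: "range e = \<U>" unfolding e_def by (rule range_from_nat_into[OF \<open>\<U> \<noteq> {}\<close> \<U>(1)])
  \<comment> \<open>Indexing the masses by natural numbers puts them in the product space
    \<open>nat \<Rightarrow> real\<close>, where convergence is coordinatewise and closure points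
    are limits of sequences.\<close>
  define \<Phi> where "\<Phi> p = ((\<lambda>i::nat. measure (K (fst p)) (e i)), snd p)" for p :: "'w \<times> 'a"
  have \<Phi>: "\<Phi> \<in> borel_measurable (N \<Otimes>\<^sub>M borel)"
    unfolding \<Phi>_def
  proof (intro borel_measurable_Pair measurable_coordinatewise_then_product)
    fix i
    have "e i \<in> sets borel" using \<U>(2) e by auto
    then show "(\<lambda>p. measure (K (fst p)) (e i)) \<in> borel_measurable (N \<Otimes>\<^sub>M borel)"
      by (intro measurable_compose[OF measurable_compose[OF measurable_fst measurable_prob_algebraD[OF K]]
          measurable_measure_subprob_algebra])
  qed measurable
  \<comment> \<open>The inclusion with content is from right to left: if \<open>\<Phi> p\<close> is
    a limit of images of points of \<open>?C\<close>, stability of the regions puts \<open>p\<close>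
    itself in \<open>?C\<close>.\<close>
  have "?C = \<Phi> -` closure (\<Phi> ` ?C) \<inter> space (N \<Otimes>\<^sub>M borel)"
  proof (intro equalityI subsetI)
    fix p assume "p \<in> ?C"
    then show "p \<in> \<Phi> -` closure (\<Phi> ` ?C) \<inter> space (N \<Otimes>\<^sub>M borel)"
      using closure_subset[of "\<Phi> ` ?C"] by blast
  next
    fix p assume p: "p \<in> \<Phi> -` closure (\<Phi> ` ?C) \<inter> space (N \<Otimes>\<^sub>M borel)"
    then have pN: "fst p \<in> space N" by (auto simp: space_pair_measure)
    have "\<Phi> p \<in> closure (\<Phi> ` ?C)" using p by simp
    then obtain q where q: "\<And>n. q n \<in> \<Phi> ` ?C" "q \<longlonglongrightarrow> \<Phi> p"
      unfolding closure_sequential by blast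
    then have "\<forall>n. \<exists>c. c \<in> ?C \<and> q n = \<Phi> c" by blast
    from choice[OF this] obtain c where c: "\<And>n. c n \<in> ?C" "\<And>n. q n = \<Phi> (c n)" by blast
    have cN: "fst (c n) \<in> space N" for n using c(1)[of n] by (auto simp: space_pair_measure)
    have "\<forall>n. \<exists>u. u \<in> cball 0 \<tau> \<and> snd (c n) \<in> subdifferential (\<phi> (fst (c n))) u"
      using c(1) region[OF cN] by blast
    from choice[OF this] obtain u where u: "\<And>n. u n \<in> cball 0 \<tau>"
      "\<And>n. snd (c n) \<in> subdifferential (\<phi> (fst (c n))) (u n)" by blast
    have lim: "(\<lambda>n. fst (q n)) \<longlonglongrightarrow> fst (\<Phi> p)" "(\<lambda>n. snd (q n)) \<longlonglongrightarrow> snd (\<Phi> p)"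
      using q(2) by (auto intro: tendsto_fst tendsto_snd)
    have coord: "(\<lambda>n. fst (q n) i) \<longlonglongrightarrow> fst (\<Phi> p) i" for i
      using continuous_on_tendsto_compose[OF continuous_on_product_coordinates lim(1)] by simp
    interpret converging_transports "\<lambda>n. \<phi> (fst (c n))" "\<lambda>n. G (fst (c n))" "\<lambda>n. K (fst (c n))"
      "\<phi> (fst p)" "G (fst p)" "K (fst p)" \<U>
    proof
      fix U assume "U \<in> \<U>"
      then obtain i where "U = e i" using e by blast
      then show "(\<lambda>n. measure (K (fst (c n))) U) \<longlonglongrightarrow> measure (K (fst p)) U"
        using coord[of i] by (simp add: c(2) \<Phi>_def)
    qed (use \<U>(2,3) tr cN pN in auto)
    have "snd p \<in> (\<Union>v\<in>cball 0 \<tau>. subdifferential (\<phi> (fst p)) v)"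
      by (rule region_closed[OF \<tau> u]) (use lim(2) in \<open>simp add: c(2) \<Phi>_def\<close>)
    then show "p \<in> ?C" using p region[OF pN] by blast
  qed
  moreover have "\<Phi> -` closure (\<Phi> ` ?C) \<inter> space (N \<Otimes>\<^sub>M borel) \<in> sets (N \<Otimes>\<^sub>M borel)"
    by (rule measurable_sets[OF \<Phi>]) auto
  ultimately show ?thesis by simp
qed

section \<open>Application to the time series\<close>

lemma subalgebra_past_sigma:
  assumes "\<And>s. X s \<in> borel_measurable M"
  shows "subalgebra M (past_sigma M X t)"
  unfolding subalgebra_def past_sigma_def
proof
  show "space (sigma (space M) (\<Union>s\<in>{..t}. {X s -` B \<inter> space M | B. B \<in> sets borel})) = space M"
    by (intro space_measure_of) auto
  have "(\<Union>s\<in>{..t}. {X s -` B \<inter> space M | B. B \<in> sets borel}) \<subseteq> sets M"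
    using assms by (auto intro: measurable_sets)
  then show "sets (sigma (space M) (\<Union>s\<in>{..t}. {X s -` B \<inter> space M | B. B \<in> sets borel})) \<subseteq> sets M"
    by (subst sets_measure_of) (auto intro!: sets.sigma_sets_subset)
qed

lemma quantile_region_measure:
  fixes \<nu> :: "'a::euclidean_space measure"
  assumes Q: "is_quantile_map \<nu> Q" and \<tau>: "0 < \<tau>" "\<tau> < 1"
  shows "measure \<nu> (quantile_region Q \<tau>) \<ge> \<tau>"
    and "absolutely_continuous lborel \<nu> \<Longrightarrow> measure \<nu> (quantile_region Q \<tau>) = \<tau>"
proof -
  obtain \<phi> where \<phi>: "quantile_potential \<nu> \<phi>" "\<And>u. u \<in> ball 0 1 \<Longrightarrow> Q u = subdifferential \<phi> u"
    using Q by (auto simp: is_quantile_map_def)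
  obtain G where tr: "subgradient_transport \<phi> G \<nu>" by (rule quantile_potential_imp_transport[OF \<phi>(1)])
  have R: "quantile_region Q \<tau> = (\<Union>u\<in>cball 0 \<tau>. subdifferential \<phi> u)"
    unfolding quantile_region_def using \<tau> by (intro SUP_cong \<phi>(2)) auto
  show "measure \<nu> (quantile_region Q \<tau>) \<ge> \<tau>"
    "absolutely_continuous lborel \<nu> \<Longrightarrow> measure \<nu> (quantile_region Q \<tau>) = \<tau>"
    unfolding R using transport_region_measure[OF tr \<tau>] by auto
qed

theorem lemma2p2:
  fixes M :: "'w measure"
    and X :: "int \<Rightarrow> 'w \<Rightarrow> real^'d"
    and t :: int
    and K :: "'w \<Rightarrow> (real^'d) measure"
    and Q :: "'w \<Rightarrow> real^'d \<Rightarrow> (real^'d) set"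
  assumes "prob_space M"
    and "\<And>s. X s \<in> borel_measurable M"
    and "\<And>s. absolutely_continuous lborel (distr M borel (X s))"
    and "is_regular_cond_distr M (past_sigma M X t) (X (t + 1)) K"
    and "is_cond_quantile_map M K Q"
  shows "(\<forall>\<tau>\<in>{0<..<1}.
            {\<omega> \<in> space M. X (t + 1) \<omega> \<in> quantile_region (Q \<omega>) \<tau>} =
              {\<omega> \<in> space M. distribution_map (Q \<omega>) (X (t + 1) \<omega>) \<inter> cball 0 \<tau> \<noteq> {}} \<and>
            {\<omega> \<in> space M. X (t + 1) \<omega> \<in> quantile_region (Q \<omega>) \<tau>} \<in> sets M \<and>
            (AE \<omega> in M.
               real_cond_exp M (past_sigma M X t)
                 (indicator {\<omega> \<in> space M. X (t + 1) \<omega> \<in> quantile_region (Q \<omega>) \<tau>}) \<omega> \<ge> \<tau>)) \<and>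
         ((AE \<omega> in M. absolutely_continuous lborel (K \<omega>)) \<longrightarrow>
          (\<forall>\<tau>\<in>{0<..<1}. AE \<omega> in M.
               real_cond_exp M (past_sigma M X t)
                 (indicator {\<omega> \<in> space M. X (t + 1) \<omega> \<in> quantile_region (Q \<omega>) \<tau>}) \<omega> = \<tau>))"
proof -
  let ?N = "past_sigma M X t" and ?Y = "X (t + 1)"
  let ?E = "\<lambda>\<tau>. {\<omega> \<in> space M. ?Y \<omega> \<in> quantile_region (Q \<omega>) \<tau>}"
  have sub: "subalgebra M ?N" by (rule subalgebra_past_sigma[OF assms(2)])
  then have spN: "space ?N = space M" by (simp add: subalgebra_def)
  have Q: "is_quantile_map (K \<omega>) (Q \<omega>)" if "\<omega> \<in> space M" for \<omega>
    using assms(5) that by (simp add: is_cond_quantile_map_def)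
  have KN: "K \<in> measurable ?N (prob_algebra borel)"
    using assms(4) by (simp add: is_regular_cond_distr_def)
  have eq: "?E \<tau> = {\<omega> \<in> space M. distribution_map (Q \<omega>) (?Y \<omega>) \<inter> cball 0 \<tau> \<noteq> {}}" if "\<tau> < 1" for \<tau>
  proof -
    \<comment> \<open>\<open>distribution_map\<close> collects points of the open ball only, and
      \<open>\<tau> < 1\<close> keeps the closed ball inside it.\<close>
    have "cball 0 \<tau> \<subseteq> ball (0 :: real^'d) 1" using that by auto
    then show ?thesis unfolding quantile_region_def distribution_map_def by blast
  qed
  have main: "?E \<tau> \<in> sets M"
    "AE \<omega> in M. real_cond_exp M ?N (indicator (?E \<tau>)) \<omega> = measure (K \<omega>) (quantile_region (Q \<omega>) \<tau>)"
    if \<tau>: "\<tau> < 1" for \<tau>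
  proof -
    let ?C = "{p \<in> space (?N \<Otimes>\<^sub>M borel). snd p \<in> quantile_region (Q (fst p)) \<tau>}"
    have C: "?C \<in> sets (?N \<Otimes>\<^sub>M borel)"
      by (rule quantile_region_measurable[OF KN Q \<tau>]) (simp add: spN)
    have E: "{\<omega> \<in> space M. (\<omega>, ?Y \<omega>) \<in> ?C} = ?E \<tau>" by (auto simp: space_pair_measure spN)
    note cond = real_cond_exp_regular[OF assms(1) sub assms(2,4) C, unfolded E]
    show "?E \<tau> \<in> sets M" by (rule cond(1))
    have "Pair \<omega> -` ?C = quantile_region (Q \<omega>) \<tau>" if "\<omega> \<in> space M" for \<omega>
      using that by (auto simp: space_pair_measure spN)
    with cond(2) show "AE \<omega> in M. real_cond_exp M ?N (indicator (?E \<tau>)) \<omega> = measure (K \<omega>) (quantile_region (Q \<omega>) \<tau>)"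
      by (auto elim: AE_mp intro!: AE_I2)
  qed
  show ?thesis
  proof (intro conjI ballI impI)
    fix \<tau> :: real assume \<tau>: "\<tau> \<in> {0<..<1}"
    then have \<tau>': "0 < \<tau>" "\<tau> < 1" by auto
    show "?E \<tau> = {\<omega> \<in> space M. distribution_map (Q \<omega>) (?Y \<omega>) \<inter> cball 0 \<tau> \<noteq> {}}" by (rule eq[OF \<tau>'(2)])
    show "?E \<tau> \<in> sets M" by (rule main(1)[OF \<tau>'(2)])
    show "AE \<omega> in M. real_cond_exp M ?N (indicator (?E \<tau>)) \<omega> \<ge> \<tau>"
      using main(2)[OF \<tau>'(2)] AE_space by eventually_elim (use quantile_region_measure(1)[OF Q \<tau>'] in auto)
  next
    fix \<tau> :: real assume ac: "AE \<omega> in M. absolutely_continuous lborel (K \<omega>)" and \<tau>: "\<tau> \<in> {0<..<1}"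
    then have \<tau>': "0 < \<tau>" "\<tau> < 1" by auto
    show "AE \<omega> in M. real_cond_exp M ?N (indicator (?E \<tau>)) \<omega> = \<tau>"
      using main(2)[OF \<tau>'(2)] AE_space ac by eventually_elim (use quantile_region_measure(2)[OF Q \<tau>'] in auto)
  qed
qed

end
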